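(* Let $\Delta \ge 3$ be an integer and let $\lambda_c(\Delta) = \frac{(\Delta-1)^{\Delta-1}}{(\Delta-2)^{\Delta}}$. For any $n$-vertex graph $G=(V,E)$ of maximum degree $\Delta$, the Glauber dynamics for the hardcore model on $G$ with fugacity $\lambda = \lambda_c(\Delta)$ has mixing time $$T_{\mathrm{mix}}(P_{\mathrm{GD}}) = O\left( n^{4+\frac{4}{\Delta-2}} \log \Delta\right),$$ where the implied constant does not depend on $n$ or $G$.
   Context: For a graph $G=(V,E)$, let $\mathcal{I}(G)$ be the set of independent sets of $G$. The hardcore model on $G$ with fugacity $\lambda>0$ is the Gibbs distribution $\mu_{G,\lambda}(\sigma) = \lambda^{|\sigma|}/Z_{G,\lambda}$ for $\sigma\in\mathcal{I}(G)$, where $Z_{G,\lambda}=\sum_{\sigma\in\mathcal{I}(G)}\lambda^{|\sigma|}$. The Glauber dynamics $P_{\mathrm{GD}}$ is the Markov chain on $\mathcal{I}(G)$ which, from the current set $\sigma_t$, picks $v\in V$ uniformly at random, sets $S=\sigma_t\setminus\{v\}$; if $S\cup\{v\}\notin\mathcal{I}(G)$ then $\sigma_{t+1}=S$; otherwise $\sigma_{t+1}=S\cup\{v\}$ with probability $\lambda/(1+\lambda)$ and $\sigma_{t+1}=S$ with probability $1/(1+\lambda)$. Its mixing time is $T_{\mathrm{mix}}(P_{\mathrm{GD}}) = \max_{\sigma_0\in\mathcal{I}(G)}\min\{t\in\mathbb{N} : d_{\mathrm{TV}}(P_{\mathrm{GD}}^t(\sigma_0,\cdot),\mu_{G,\lambda})\le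 1/4\}$, where $d_{\mathrm{TV}}$ is total variation distance. *)

theory Defs
  imports "HOL-Probability.Probability"
begin

definition simple_graph :: "'a set \<Rightarrow> 'a set set \<Rightarrow> bool" where
  "simple_graph V E \<longleftrightarrow> finite V \<and> (\<forall>e\<in>E. e \<subseteq> V \<and> card e = 2)"

definition vertex_degree :: "'a set set \<Rightarrow> 'a \<Rightarrow> nat" where
  "vertex_degree E v = card {e \<in> E. v \<in> e}"

text \<open>The inserted 0 only fixes the value for the graph without vertices.\<close>

definition max_degree :: "'a set \<Rightarrow> 'a set set \<Rightarrow> nat" where
  "max_degree V E = Max (insert 0 (vertex_degree E ` V))"

definition independent_sets :: "'a set \<Rightarrow> 'a set set \<Rightarrow> 'a set set" where
  "independent_sets V E = {S. S \<subseteq> V \<and> (\<forall>u\<in>S. \<forall>v\<in>S. {u, v} \<notin> E)}"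

definition partition_fun :: "'a set \<Rightarrow> 'a set set \<Rightarrow> real \<Rightarrow> real" where
  "partition_fun V E lam = (\<Sum>\<sigma>\<in>independent_sets V E. lam ^ card \<sigma>)"

definition hardcore :: "'a set \<Rightarrow> 'a set set \<Rightarrow> real \<Rightarrow> 'a set \<Rightarrow> real" where
  "hardcore V E lam \<sigma> =
     (if \<sigma> \<in> independent_sets V E then lam ^ card \<sigma> / partition_fun V E lam else 0)"

text \<open>Meaningful only for nonempty \<open>V\<close>, where \<^term>\<open>pmf_of_set V\<close> is the uniform choice of a vertex.\<close>

definition glauber_step :: "'a set \<Rightarrow> 'a set set \<Rightarrow> real \<Rightarrow> 'a set \<Rightarrow> 'a set pmf" where
  "glauber_step V E lam \<sigma> =
     bind_pmf (pmf_of_set V) (\<lambda>v.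
       let S = \<sigma> - {v} in
       if S \<union> {v} \<notin> independent_sets V E then return_pmf S
       else map_pmf (\<lambda>b. if b then S \<union> {v} else S) (bernoulli_pmf (lam / (1 + lam))))"

primrec iterate_kernel :: "('s \<Rightarrow> 's pmf) \<Rightarrow> nat \<Rightarrow> 's \<Rightarrow> 's pmf" where
  "iterate_kernel P 0 x = return_pmf x"
| "iterate_kernel P (Suc t) x = bind_pmf (iterate_kernel P t x) P"

definition tv_dist :: "'s set \<Rightarrow> ('s \<Rightarrow> real) \<Rightarrow> ('s \<Rightarrow> real) \<Rightarrow> real" where
  "tv_dist \<Omega> p q = (1 / 2) * (\<Sum>x\<in>\<Omega>. \<bar>p x - q x\<bar>)"

text \<open>The value is an extended natural number, so that the minimum over an empty set
  of times is infinite: a finite bound on the mixing time includes the claim that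
  the chain gets within distance 1/4 from every starting state.\<close>

definition mixing_time :: "'s set \<Rightarrow> ('s \<Rightarrow> 's pmf) \<Rightarrow> ('s \<Rightarrow> real) \<Rightarrow> enat" where
  "mixing_time \<Omega> P \<mu> =
     (MAX x\<in>\<Omega>. INF t\<in>{t. tv_dist \<Omega> (pmf (iterate_kernel P t x)) \<mu> \<le> 1 / 4}. enat t)"

definition glauber_mixing_time :: "'a set \<Rightarrow> 'a set set \<Rightarrow> real \<Rightarrow> enat" where
  "glauber_mixing_time V E lam =
     mixing_time (independent_sets V E) (glauber_step V E lam) (hardcore V E lam)"

definition lambda_c :: "nat \<Rightarrow> real" where
  "lambda_c \<Delta> = (real \<Delta> - 1) ^ (\<Delta> - 1) / (real \<Delta> - 2) ^ \<Delta>"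

end

theory Submission
  imports Defs
begin

text \<open>Write \<open>d = \<Delta> - 1\<close> and parametrise the fugacity as \<open>t = a / (1 - a) ^ (d + 1)\<close>, so that
  \<open>a\<close> is the cavity marginal of the \<open>d\<close>-ary tree and \<open>a = 1 / d\<close> is the critical point.
  Removing the neighbours of a vertex one at a time, together with the potential
  \<open>min p a / (1 - d a)\<close> of a cavity marginal \<open>p\<close>, shows that the total influence of a vertex is
  at most its value \<open>(1 + a) / (1 - d a)\<close> on the regular tree; trivially it is also at most \<open>n\<close>.

  Next, reveal each vertex of a sample at fugacity \<open>\<lambda>\<close> independently with probability
  \<open>1 - t / \<lambda>\<close> if it is occupied. The expected conditional variance of a function \<open>f\<close>, as a
  function of \<open>t\<close>, vanishes at \<open>0\<close>, equals the variance of \<open>f\<close> at \<open>\<lambda>\<close>, has a multiple of the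
  Dirichlet form as its derivative at \<open>0\<close>, and its logarithmic derivative in \<open>ln t\<close> is at most the total
  influence at \<open>t\<close>. Integrating the tree bound up to \<open>1 - d a = 1 / n\<close> costs a factor
  \<open>n powr (2 \<Delta> / (\<Delta> - 2))\<close>, and the bound \<open>n\<close> costs only a constant on the rest of the way.
  The resulting Poincare inequality gives the mixing time in the usual way.\<close>

section \<open>Weighted sums over independent sets\<close>

locale finite_graph =
  fixes V :: "'a set" and E :: "'a set set"
  assumes simple: "simple_graph V E"
begin

definition nb :: "'a \<Rightarrow> 'a set" where
  "nb v = {u. {u, v} \<in> E}"

text \<open>\<open>E\<close> stays fixed while \<open>U\<close> shrinks: edges not contained in
  \<open>U\<close> do not constrain subsets of \<open>U\<close>, so a vertex set stands for its
  induced subgraph.\<close>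

abbreviation ind :: "'a set \<Rightarrow> 'a set set" where
  "ind U \<equiv> independent_sets U E"

definition wsum :: "real \<Rightarrow> 'a set \<Rightarrow> ('a set \<Rightarrow> real) \<Rightarrow> real" where
  "wsum t U f = (\<Sum>S\<in>ind U. t ^ card S * f S)"

abbreviation Z :: "real \<Rightarrow> 'a set \<Rightarrow> real" where
  "Z t U \<equiv> wsum t U (\<lambda>_. 1)"

definition ev :: "real \<Rightarrow> 'a set \<Rightarrow> ('a set \<Rightarrow> real) \<Rightarrow> real" where
  "ev t U f = wsum t U f / Z t U"

definition marg :: "real \<Rightarrow> 'a set \<Rightarrow> 'a \<Rightarrow> real" where
  "marg t U v = ev t U (\<lambda>S. of_bool (v \<in> S))"

text \<open>Given that \<open>w\<close> is occupied, the rest is hardcore on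
  \<open>U - insert w (nb w)\<close>; given that it is vacant, on \<open>U - {w}\<close>. The two
  conditional marginals are compared; vertices outside \<open>U\<close>, and \<open>w\<close>
  itself, contribute 0.\<close>

definition infl :: "real \<Rightarrow> 'a set \<Rightarrow> 'a \<Rightarrow> real" where
  "infl t U w = (\<Sum>v\<in>V. \<bar>marg t (U - insert w (nb w)) v - marg t (U - {w}) v\<bar>)"

section \<open>Neighbourhoods and independent sets of induced subgraphs\<close>

lemma finite_V: "finite V"
  using simple by (simp add: simple_graph_def)

lemma singleton_not_edge: "{v} \<notin> E"
  using simple by (force simp: simple_graph_def)

lemma nb_sym: "u \<in> nb v \<longleftrightarrow> v \<in> nb u"
  by (simp add: nb_def insert_commute)

lemma not_self_nb: "v \<notin> nb v"
  by (simp add: nb_def singleton_not_edge)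

lemma nb_subset: "nb v \<subseteq> V"
  using simple by (auto simp: nb_def simple_graph_def)

lemma finite_nb: "finite (nb v)"
  using nb_subset finite_V by (rule finite_subset)

lemma card_nb: "card (nb v) = vertex_degree E v"
proof -
  have "bij_betw (\<lambda>u. {u, v}) (nb v) {e \<in> E. v \<in> e}"
  proof (rule bij_betwI')
    show "({x, v} = {y, v}) = (x = y)" if "x \<in> nb v" "y \<in> nb v" for x y
      using that not_self_nb by (auto simp: doubleton_eq_iff)
    show "{x, v} \<in> {e \<in> E. v \<in> e}" if "x \<in> nb v" for x
      using that by (simp add: nb_def)
    show "\<exists>x\<in>nb v. e = {x, v}" if "e \<in> {e \<in> E. v \<in> e}" for e
    proof -
      have "card e = 2" "v \<in> e" "e \<in> E"
        using that simple by (auto simp: simple_graph_def)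
      then obtain x where "e = {x, v}"
        by (auto simp: card_2_iff)
      with \<open>e \<in> E\<close> show ?thesis by (auto simp: nb_def)
    qed
  qed
  then show ?thesis by (simp add: vertex_degree_def bij_betw_same_card)
qed

lemma ind_iff: "S \<in> ind U \<longleftrightarrow> S \<subseteq> U \<and> (\<forall>v\<in>S. S \<inter> nb v = {})"
  by (auto simp: independent_sets_def nb_def)

lemma finite_ind: "finite U \<Longrightarrow> finite (ind U)"
  by (rule finite_subset[of _ "Pow U"]) (auto simp: ind_iff)

lemma finite_mem_ind: "finite U \<Longrightarrow> S \<in> ind U \<Longrightarrow> finite S"
  by (auto simp: ind_iff intro: finite_subset)

lemma empty_in_ind: "{} \<in> ind U"
  by (simp add: ind_iff)

lemma insert_ind_iff:
  "insert w S \<in> ind U \<longleftrightarrow> w \<in> U \<and> S \<in> ind U \<and> S \<inter> nb w = {}"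
  using not_self_nb nb_sym by (auto simp: ind_iff)

lemma ind_mem: 
  assumes "w \<in> U"
  shows "{S \<in> ind U. w \<in> S} = insert w ` ind (U - insert w (nb w))"
proof (intro equalityI subsetI)
  fix S assume S: "S \<in> {S \<in> ind U. w \<in> S}"
  then have "S = insert w (S - {w})" by auto
  moreover have "S - {w} \<in> ind (U - insert w (nb w))"
    using S by (auto simp: ind_iff)
  ultimately show "S \<in> insert w ` ind (U - insert w (nb w))" by blast
next
  fix S assume "S \<in> insert w ` ind (U - insert w (nb w))"
  then obtain T where T: "T \<in> ind (U - insert w (nb w))" "S = insert w T" by auto
  then have "T \<in> ind U" "T \<inter> nb w = {}" by (auto simp: ind_iff)
  then show "S \<in> {S \<in> ind U. w \<in> S}" using T assms by (simp add: insert_ind_iff)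
qed

lemma ind_not_mem: "{S \<in> ind U. w \<notin> S} = ind (U - {w})"
  by (rule set_eqI, unfold mem_Collect_eq ind_iff) blast

section \<open>Weighted sums split at one vertex\<close>

lemma sum_ind_mem:
  assumes "finite U" "w \<in> U"
  shows "(\<Sum>S | S \<in> ind U \<and> w \<in> S. g S) = (\<Sum>S\<in>ind (U - insert w (nb w)). g (insert w S))"
proof -
  have "inj_on (insert w) (ind (U - insert w (nb w)))"
    by (rule inj_onI) (auto simp: ind_iff)
  then show ?thesis using ind_mem[OF assms(2)] by (simp add: sum.reindex o_def)
qed

lemma card_insert_rest:
  "finite U \<Longrightarrow> S \<in> ind (U - insert w X) \<Longrightarrow> card (insert w S) = Suc (card S)"
  using finite_mem_ind[of "U - insert w X" S] by (auto simp: ind_iff card_insert_if)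

lemma wsum_mem:
  assumes "finite U" "w \<in> U"
  shows "wsum t U (\<lambda>S. of_bool (w \<in> S) * f S)
    = t * wsum t (U - insert w (nb w)) (\<lambda>S. f (insert w S))"
proof -
  have "wsum t U (\<lambda>S. of_bool (w \<in> S) * f S) = (\<Sum>S | S \<in> ind U \<and> w \<in> S. t ^ card S * f S)"
    unfolding wsum_def
    by (rule sum.mono_neutral_cong_right) (use finite_ind assms in auto)
  also have "\<dots> = (\<Sum>S\<in>ind (U - insert w (nb w)). t ^ card (insert w S) * f (insert w S))"
    by (rule sum_ind_mem[OF assms])
  also have "\<dots> = (\<Sum>S\<in>ind (U - insert w (nb w)). t * (t ^ card S * f (insert w S)))"
    by (rule sum.cong) (simp_all add: card_insert_rest[OF assms(1)] mult.assoc)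
  finally show ?thesis by (simp add: wsum_def sum_distrib_left)
qed

lemma wsum_split:
  assumes "finite U" "w \<in> U"
  shows "wsum t U f
    = wsum t (U - {w}) f + t * wsum t (U - insert w (nb w)) (\<lambda>S. f (insert w S))"
proof -
  have "wsum t (U - {w}) f = wsum t U (\<lambda>S. of_bool (w \<notin> S) * f S)"
    unfolding wsum_def ind_not_mem[symmetric]
    by (rule sum.mono_neutral_cong_left) (use finite_ind assms in auto)
  then show ?thesis
    unfolding wsum_mem[OF assms, symmetric]
    by (simp add: wsum_def sum.distrib[symmetric] flip: distrib_left) (rule sum.cong, auto)
qed

lemma wsum_add: "wsum t U (\<lambda>S. f S + g S) = wsum t U f + wsum t U g"
  by (simp add: wsum_def distrib_left sum.distrib)

lemma wsum_cmult: "wsum t U (\<lambda>S. c * f S) = c * wsum t U f"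
  by (simp add: wsum_def sum_distrib_left mult.left_commute)

lemma wsum_const: "wsum t U (\<lambda>S. c) = c * Z t U"
  using wsum_cmult[of t U c "\<lambda>_. 1"] by simp

lemma wsum_nonneg: "t \<ge> 0 \<Longrightarrow> (\<And>S. S \<in> ind U \<Longrightarrow> f S \<ge> 0) \<Longrightarrow> wsum t U f \<ge> 0"
  unfolding wsum_def by (rule sum_nonneg) simp

lemma Z_ge_1:
  assumes "finite U" "t \<ge> 0"
  shows "Z t U \<ge> 1"
proof -
  have "(\<Sum>S\<in>{{} :: 'a set}. t ^ card S * 1) \<le> Z t U"
    unfolding wsum_def by (rule sum_mono2) (use assms finite_ind empty_in_ind in auto)
  then show ?thesis by simp
qed

section \<open>Marginals and conditioning on one vertex\<close>

lemma marg_eq: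
  assumes "finite U" "w \<in> U"
  shows "marg t U w = t * Z t (U - insert w (nb w)) / Z t U"
  using wsum_mem[OF assms, of t "\<lambda>_. 1"] by (simp add: marg_def ev_def)

lemma one_minus_marg:
  assumes "finite U" "w \<in> U" "t \<ge> 0"
  shows "1 - marg t U w = Z t (U - {w}) / Z t U"
proof -
  have "Z t U > 0" using Z_ge_1[OF assms(1,3)] by simp
  then show ?thesis
    using wsum_split[OF assms(1,2), of t "\<lambda>_. 1"] by (simp add: marg_eq[OF assms(1,2)] field_simps)
qed

lemma marg_bounds:
  assumes "finite U" "w \<in> U" "t \<ge> 0"
  shows "0 \<le> marg t U w" "marg t U w < 1"
proof -
  have Z: "Z t U > 0" "Z t (U - {w}) > 0" "Z t (U - insert w (nb w)) \<ge> 0"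
    using Z_ge_1[of U t] Z_ge_1[of "U - {w}" t] Z_ge_1[of "U - insert w (nb w)" t] assms by auto
  show "0 \<le> marg t U w"
    unfolding marg_eq[OF assms(1,2)] using Z assms(3) by simp
  have "1 - marg t U w > 0"
    unfolding one_minus_marg[OF assms] using Z by simp
  then show "marg t U w < 1" by simp
qed

lemma ev_split:
  assumes "finite U" "w \<in> U" "t \<ge> 0"
  shows "ev t U f = marg t U w * ev t (U - insert w (nb w)) (\<lambda>S. f (insert w S))
    + (1 - marg t U w) * ev t (U - {w}) f"
proof -
  have "Z t U > 0" "Z t (U - {w}) > 0" "Z t (U - insert w (nb w)) > 0"
    using Z_ge_1[of U t] Z_ge_1[of "U - {w}" t] Z_ge_1[of "U - insert w (nb w)" t] assms by auto
  then show ?thesis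
    unfolding one_minus_marg[OF assms] unfolding marg_eq[OF assms(1,2)]
    by (simp add: ev_def wsum_split[OF assms(1,2), of t f] add_divide_distrib)
qed

lemma ev_mem_insert:
  assumes "finite U" "w \<in> U" "t \<ge> 0"
  shows "ev t (U - insert w (nb w)) (\<lambda>S. of_bool (v \<in> insert w S))
    = of_bool (v = w) + marg t (U - insert w (nb w)) v"
proof -
  have "wsum t (U - insert w (nb w)) (\<lambda>S. of_bool (v \<in> insert w S))
      = wsum t (U - insert w (nb w)) (\<lambda>S. of_bool (v = w) + of_bool (v \<in> S))"
    unfolding wsum_def by (rule sum.cong) (auto simp: ind_iff)
  moreover have "Z t (U - insert w (nb w)) > 0"
    using Z_ge_1[of "U - insert w (nb w)" t] assms by auto
  ultimately show ?thesis
    by (simp add: ev_def marg_def wsum_add wsum_const[of _ _ "of_bool (v = w)"] add_divide_distrib)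
qed

text \<open>Total probability for the state of \<open>w\<close>; the indicator accounts for
  \<open>v = w\<close>, which the conditioned graph no longer contains.\<close>

lemma marg_split:
  assumes "finite U" "w \<in> U" "t \<ge> 0"
  shows "marg t U v = marg t U w * (of_bool (v = w) + marg t (U - insert w (nb w)) v)
    + (1 - marg t U w) * marg t (U - {w}) v"
  using ev_split[OF assms, of "\<lambda>S. of_bool (v \<in> S)"] unfolding ev_mem_insert[OF assms]
  by (simp add: marg_def)

lemma sum_infl_le:
  assumes "w \<in> V"
  shows "(\<Sum>v\<in>V. \<bar>of_bool (v = w) + marg t (U - insert w (nb w)) v - marg t (U - {w}) v\<bar>)
    \<le> 1 + infl t U w"
proof -
  have "(\<Sum>v\<in>V. \<bar>of_bool (v = w) + marg t (U - insert w (nb w)) v - marg t (U - {w}) v\<bar>)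
    \<le> (\<Sum>v\<in>V. of_bool (v = w) + \<bar>marg t (U - insert w (nb w)) v - marg t (U - {w}) v\<bar>)"
    by (rule sum_mono) (auto simp: abs_if)
  also have "\<dots> = (\<Sum>v\<in>V. if v = w then 1 else 0) + infl t U w"
    by (simp add: sum.distrib infl_def of_bool_def)
  finally show ?thesis using assms finite_V by simp
qed

text \<open>By \<open>marg_split\<close>, deleting \<open>w\<close> changes each marginal by
  \<open>marg t U w\<close> times the difference between \<open>w\<close> occupied and
  \<open>w\<close> vacant. The summand 1 accounts for \<open>w\<close> itself.\<close>

lemma marg_remove_diff:
  assumes "U \<subseteq> V" "w \<in> U" "t \<ge> 0"
  shows "(\<Sum>v\<in>V. \<bar>marg t U v - marg t (U - {w}) v\<bar>) \<le> marg t U w * (1 + infl t U w)"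
proof -
  have U: "finite U" using assms(1) finite_V by (rule finite_subset)
  have "marg t U v - marg t (U - {w}) v
      = marg t U w * (of_bool (v = w) + marg t (U - insert w (nb w)) v - marg t (U - {w}) v)" for v
    using marg_split[OF U assms(2,3), of v] by (simp add: algebra_simps)
  then have "(\<Sum>v\<in>V. \<bar>marg t U v - marg t (U - {w}) v\<bar>) = marg t U w *
      (\<Sum>v\<in>V. \<bar>of_bool (v = w) + marg t (U - insert w (nb w)) v - marg t (U - {w}) v\<bar>)"
    using marg_bounds(1)[OF U assms(2,3)] by (simp add: abs_mult sum_distrib_left)
  also have "\<dots> \<le> marg t U w * (1 + infl t U w)"
    by (rule mult_left_mono) (use sum_infl_le assms marg_bounds(1)[OF U assms(2,3)] in auto)
  finally show ?thesis .
qed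

end

section \<open>Total influence\<close>

text \<open>Every factor is bounded by an exponential tangent to \<open>1 - y\<close> at
  \<open>y = a\<close>, and the exponents \<open>D / c\<close> and \<open>- (D / c)\<close> cancel.
  Equality holds if there are \<open>d\<close> children, all with \<open>q x = a\<close>.\<close>

lemma prod_potential_le:
  fixes a :: real
  assumes "0 \<le> a" "a < 1" "finite N" "card N \<le> d" "\<And>x. x \<in> N \<Longrightarrow> q x \<le> 1"
  shows "(\<Prod>x\<in>N. 1 - q x) * (1 - a - (real d * a - (\<Sum>x\<in>N. q x))) \<le> (1 - a) ^ (d + 1)"
proof -
  define c where "c = 1 - a"
  define D where "D = real d * a - (\<Sum>x\<in>N. q x)"
  have c: "c > 0" using assms by (simp add: c_def)
  have *: "1 - y \<le> c * exp ((a - y) / c)" for y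
  proof -
    have "1 - y = c * (1 + (a - y) / c)" using c by (simp add: c_def field_simps)
    also have "\<dots> \<le> c * exp ((a - y) / c)"
      using c by (intro mult_left_mono exp_ge_add_one_self) auto
    finally show ?thesis .
  qed
  have "(\<Prod>x\<in>N. 1 - q x) \<le> (\<Prod>x\<in>N. c * exp ((a - q x) / c)) * 1"
    using assms * by (simp add: prod_mono)
  \<comment> \<open>The missing \<open>d - card N\<close> children are padded by the tangent bound
    at \<open>y = 0\<close>, which is at least 1.\<close>
  also have "\<dots> \<le> (\<Prod>x\<in>N. c * exp ((a - q x) / c)) * (c * exp (a / c)) ^ (d - card N)"
    using *[of 0] c by (intro mult_left_mono one_le_power prod_nonneg) auto
  also have "\<dots> = c ^ d * exp (D / c)"
  proof -
    have "c ^ card N * c ^ (d - card N) = c ^ d"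
      using assms(4) by (simp flip: power_add)
    moreover have "(\<Prod>x\<in>N. exp ((a - q x) / c)) * exp (a / c) ^ (d - card N) = exp (D / c)"
    proof -
      have "(\<Sum>x\<in>N. (a - q x) / c) + real (d - card N) * (a / c) = D / c"
        using assms(4) c by (simp add: D_def sum_divide_distrib[symmetric] sum_subtractf of_nat_diff field_simps)
      then show ?thesis
        using assms(3) by (simp add: exp_sum[symmetric] exp_of_nat_mult[symmetric] exp_add[symmetric])
    qed
    moreover have "(\<Prod>x\<in>N. c * exp ((a - q x) / c)) * (c * exp (a / c)) ^ (d - card N)
        = (c ^ card N * c ^ (d - card N))
          * ((\<Prod>x\<in>N. exp ((a - q x) / c)) * exp (a / c) ^ (d - card N))"
      by (simp add: prod.distrib power_mult_distrib)
    ultimately show ?thesis by simp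
  qed
  finally have 1: "(\<Prod>x\<in>N. 1 - q x) \<le> c ^ d * exp (D / c)" .
  have 2: "c - D \<le> c * exp (- (D / c))"
    using *[of "a + D"] by (simp add: c_def)
  have "(\<Prod>x\<in>N. 1 - q x) * (c - D) \<le> (\<Prod>x\<in>N. 1 - q x) * (c * exp (- (D / c)))"
    using 2 assms by (intro mult_left_mono prod_nonneg) auto
  also have "\<dots> \<le> (c ^ d * exp (D / c)) * (c * exp (- (D / c)))"
    using 1 c by (intro mult_right_mono) auto
  also have "\<dots> = c ^ (d + 1)" by (simp add: exp_minus field_simps)
  finally show ?thesis by (simp add: c_def D_def)
qed

text \<open>The fugacity at which the infinite regular tree with \<open>d\<close> children per vertex has cavity
  marginal \<open>a\<close>.\<close>

definition tree_fugacity :: "nat \<Rightarrow> real \<Rightarrow> real" where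
  "tree_fugacity d a = a / (1 - a) ^ (d + 1)"

context finite_graph
begin

text \<open>The vertices of \<open>N\<close> are deleted one at a time; \<open>q x\<close> is the
  marginal of \<open>x\<close> at the moment of its deletion, truncated at \<open>a\<close>.
  Partition functions pick up factors \<open>1 - marg\<close>, which truncation only enlarges, and
  the changes of the marginals add up by the triangle inequality.\<close>

lemma marg_remove_set:
  assumes "U \<subseteq> V" "N \<subseteq> U" "t \<ge> 0" "c > 0"
    and bound: "\<And>U' x. U' \<subseteq> U \<Longrightarrow> x \<in> U' \<Longrightarrow> x \<in> N \<Longrightarrow>
      marg t U' x * (1 + infl t U' x) \<le> min (marg t U' x) a / c"
  shows "\<exists>q. (\<forall>x\<in>N. q x \<le> a \<and> q x < 1) \<and>
    Z t (U - N) \<le> Z t U * (\<Prod>x\<in>N. 1 - q x) \<and>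
    (\<Sum>v\<in>V. \<bar>marg t U v - marg t (U - N) v\<bar>) \<le> (\<Sum>x\<in>N. q x) / c"
proof -
  have fU: "finite U" using assms(1) finite_V by (rule finite_subset)
  then have "finite N" using assms(2) finite_subset by blast
  then show ?thesis using assms(2) bound
  proof (induction N)
    case empty
    then show ?case by simp
  next
    case (insert x N)
    let ?W = "U - N"
    have "\<exists>q. (\<forall>x\<in>N. q x \<le> a \<and> q x < 1) \<and>
      Z t ?W \<le> Z t U * (\<Prod>x\<in>N. 1 - q x) \<and>
      (\<Sum>v\<in>V. \<bar>marg t U v - marg t ?W v\<bar>) \<le> (\<Sum>x\<in>N. q x) / c"
      using insert.prems by (intro insert.IH) simp_all
    then obtain q where q: "\<forall>x\<in>N. q x \<le> a \<and> q x < 1"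
      "Z t ?W \<le> Z t U * (\<Prod>x\<in>N. 1 - q x)"
      "(\<Sum>v\<in>V. \<bar>marg t U v - marg t ?W v\<bar>) \<le> (\<Sum>x\<in>N. q x) / c"
      by (elim exE conjE)
    have xW: "x \<in> ?W" and W: "?W \<subseteq> V" "finite ?W"
      using insert.hyps insert.prems(1) assms(1) fU by auto
    define r where "r = min (marg t ?W x) a"
    have m: "marg t ?W x < 1" using marg_bounds[OF W(2) xW assms(3)] by simp
    have Wx: "?W - {x} = U - insert x N" by auto
    have Wpos: "Z t ?W > 0" using Z_ge_1[OF W(2) assms(3)] by simp
    have "Z t (U - insert x N) = Z t ?W * (1 - marg t ?W x)"
      using one_minus_marg[OF W(2) xW assms(3)] Wpos by (simp add: Wx)
    also have "\<dots> \<le> Z t ?W * (1 - r)"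
      using Wpos by (intro mult_left_mono) (auto simp: r_def)
    also have "\<dots> \<le> (Z t U * (\<Prod>x\<in>N. 1 - q x)) * (1 - r)"
      using q(2) m by (intro mult_right_mono) (auto simp: r_def)
    finally have Z: "Z t (U - insert x N) \<le> Z t U * ((1 - r) * (\<Prod>x\<in>N. 1 - q x))"
      by (simp add: mult_ac)
    have "(\<Sum>v\<in>V. \<bar>marg t ?W v - marg t (U - insert x N) v\<bar>) \<le> marg t ?W x * (1 + infl t ?W x)"
      using marg_remove_diff[OF W(1) xW assms(3)] by (simp add: Wx)
    also have "\<dots> \<le> r / c"
      unfolding r_def by (rule insert.prems(2)) (use xW in auto)
    finally have "(\<Sum>v\<in>V. \<bar>marg t U v - marg t ?W v\<bar>)
        + (\<Sum>v\<in>V. \<bar>marg t ?W v - marg t (U - insert x N) v\<bar>) \<le> (r + (\<Sum>x\<in>N. q x)) / c"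
      using q(3) by (simp add: add_divide_distrib)
    moreover have "(\<Sum>v\<in>V. \<bar>marg t U v - marg t (U - insert x N) v\<bar>)
      \<le> (\<Sum>v\<in>V. \<bar>marg t U v - marg t ?W v\<bar>)
        + (\<Sum>v\<in>V. \<bar>marg t ?W v - marg t (U - insert x N) v\<bar>)"
      unfolding sum.distrib[symmetric] by (rule sum_mono) simp
    ultimately have S: "(\<Sum>v\<in>V. \<bar>marg t U v - marg t (U - insert x N) v\<bar>)
      \<le> (r + (\<Sum>x\<in>N. q x)) / c" by linarith
    let ?q = "\<lambda>y. if y = x then r else q y"
    have eq: "(\<Prod>y\<in>N. 1 - ?q y) = (\<Prod>y\<in>N. 1 - q y)" "(\<Sum>y\<in>N. ?q y) = (\<Sum>y\<in>N. q y)"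
      using insert.hyps by (auto intro!: prod.cong sum.cong)
    have eq2: "(\<Prod>y\<in>insert x N. 1 - ?q y) = (1 - r) * (\<Prod>y\<in>N. 1 - q y)"
      "(\<Sum>y\<in>insert x N. ?q y) = r + (\<Sum>y\<in>N. q y)"
      unfolding prod.insert[OF insert.hyps] sum.insert[OF insert.hyps] eq by simp_all
    have "\<forall>y\<in>insert x N. ?q y \<le> a \<and> ?q y < 1"
      using q(1) m by (auto simp: r_def)
    with Z S show ?case
      by (intro exI[of _ ?q] conjI) (simp_all only: eq2)
  qed
qed

context
  fixes d :: nat and a :: real
  assumes a: "0 < a" "real d * a < 1" "a < 1"
begin

abbreviation (input) "ta \<equiv> tree_fugacity d a"

lemma ta_pos: "ta > 0"
  using a by (simp add: tree_fugacity_def)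

text \<open>The graph with \<open>w\<close> occupied arises from the graph with \<open>w\<close>
  vacant by deleting the neighbours of \<open>w\<close>, so \<open>marg_remove_set\<close> applies
  inside \<open>U - {w}\<close>.\<close>

lemma infl_le_of_bound:
  assumes "U \<subseteq> V" "w \<in> U"
    and bound: "\<forall>U' x. U' \<subseteq> U - {w} \<and> x \<in> U' \<and> x \<in> nb w \<longrightarrow>
      marg ta U' x * (1 + infl ta U' x) \<le> min (marg ta U' x) a / (1 - real d * a)"
  shows "\<exists>q. (\<forall>x\<in>nb w \<inter> U. q x \<le> a \<and> q x < 1) \<and>
    Z ta (U - insert w (nb w)) \<le> Z ta (U - {w}) * (\<Prod>x\<in>nb w \<inter> U. 1 - q x) \<and>
    infl ta U w \<le> (\<Sum>x\<in>nb w \<inter> U. q x) / (1 - real d * a)"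
proof -
  have sub: "U - {w} \<subseteq> V" "nb w \<inter> U \<subseteq> U - {w}" using assms not_self_nb by auto
  have eq: "U - {w} - nb w \<inter> U = U - insert w (nb w)" by auto
  have "\<exists>q. (\<forall>x\<in>nb w \<inter> U. q x \<le> a \<and> q x < 1) \<and>
    Z ta (U - {w} - nb w \<inter> U) \<le> Z ta (U - {w}) * (\<Prod>x\<in>nb w \<inter> U. 1 - q x) \<and>
    (\<Sum>v\<in>V. \<bar>marg ta (U - {w}) v - marg ta (U - {w} - nb w \<inter> U) v\<bar>)
      \<le> (\<Sum>x\<in>nb w \<inter> U. q x) / (1 - real d * a)"
    by (rule marg_remove_set[OF sub]) (use a ta_pos bound in auto)
  then show ?thesis unfolding eq by (simp add: infl_def abs_minus_commute)
qed

text \<open>Induction on the size of \<open>U\<close>: a neighbour \<open>x\<close> of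
  \<open>w\<close> has lost \<open>w\<close>, so at most \<open>d\<close> of its neighbours remain
  and the invariant reproduces itself. With \<open>S\<close> the sum of the \<open>q x\<close>, it
  suffices that \<open>?p * (s + S)\<close> is at most \<open>?p\<close> and at most
  \<open>a\<close>.\<close>

lemma cavity_bound:
  assumes "U \<subseteq> V" "\<And>v. card (nb v) \<le> d + 1" "w \<in> U" "card (nb w \<inter> U) \<le> d"
  shows "marg ta U w * (1 + infl ta U w) \<le> min (marg ta U w) a / (1 - real d * a)"
  using assms(1,3,4)
proof (induction "card U" arbitrary: U w rule: less_induct)
  case less
  have fU: "finite U" using less.prems(1) finite_V by (rule finite_subset)
  let ?N = "nb w \<inter> U" and ?p = "marg ta U w"
  define s where "s = 1 - real d * a"
  have s: "s > 0" using a by (simp add: s_def)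
  have ta0: "ta \<ge> 0" using ta_pos by simp
  have "marg ta U' x * (1 + infl ta U' x) \<le> min (marg ta U' x) a / (1 - real d * a)"
    if U': "U' \<subseteq> U - {w}" "x \<in> U'" "x \<in> nb w" for U' x
  proof (rule less.hyps)
    show "card U' < card U"
      using U' less.prems(2) fU by (intro psubset_card_mono) auto
    show "U' \<subseteq> V" "x \<in> U'" using U' less.prems by auto
    have "nb x \<inter> U' \<subset> nb x" using U' nb_sym by blast
    then have "card (nb x \<inter> U') < card (nb x)" using finite_nb by (rule psubset_card_mono[rotated])
    then show "card (nb x \<inter> U') \<le> d" using assms(2)[of x] by simp
  qed
  then have "\<forall>U' x. U' \<subseteq> U - {w} \<and> x \<in> U' \<and> x \<in> nb w \<longrightarrow>
      marg ta U' x * (1 + infl ta U' x) \<le> min (marg ta U' x) a / (1 - real d * a)"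
    by blast
  from infl_le_of_bound[OF less.prems(1,2) this]
  obtain q where q: "\<forall>x\<in>?N. q x \<le> a \<and> q x < 1"
    "Z ta (U - insert w (nb w)) \<le> Z ta (U - {w}) * (\<Prod>x\<in>?N. 1 - q x)"
    "infl ta U w \<le> (\<Sum>x\<in>?N. q x) / s"
    unfolding s_def by (elim exE conjE)
  define S where "S = (\<Sum>x\<in>?N. q x)"
  define PP where "PP = (\<Prod>x\<in>?N. 1 - q x)"
  have p: "0 \<le> ?p" "?p < 1" using marg_bounds[OF fU less.prems(2) ta0] by auto
  have S: "S \<le> real d * a"
  proof -
    have "S \<le> real (card ?N) * a" unfolding S_def using q(1) by (intro sum_bounded_above) auto
    also have "\<dots> \<le> real d * a" using less.prems(3) a by (intro mult_right_mono) auto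
    finally show ?thesis .
  qed
  have Zpos: "Z ta U > 0" "Z ta (U - {w}) > 0"
    using Z_ge_1[of U ta] Z_ge_1[of "U - {w}" ta] fU ta0 by auto
  have "?p / (1 - ?p) = ta * Z ta (U - insert w (nb w)) / Z ta (U - {w})"
    unfolding one_minus_marg[OF fU less.prems(2) ta0] unfolding marg_eq[OF fU less.prems(2)]
    using Zpos by simp
  also have "\<dots> \<le> ta * PP"
    using q(2) Zpos ta_pos by (simp add: PP_def field_simps)
  finally have odds: "?p \<le> ta * PP * (1 - ?p)" using p by (simp add: field_simps)
  have "PP * (1 - a - (real d * a - S)) \<le> (1 - a) ^ (d + 1)"
    unfolding PP_def S_def
    by (rule prod_potential_le) (use a less.prems(3) finite_nb q(1) in \<open>auto simp: less_imp_le\<close>)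
  then have "ta * (PP * (1 - a - (real d * a - S))) \<le> ta * (1 - a) ^ (d + 1)"
    using ta_pos by (intro mult_left_mono) auto
  \<comment> \<open>The choice of \<open>ta\<close> enters here: it turns the bound of
    \<open>prod_potential_le\<close> into \<open>a\<close>.\<close>
  also have "\<dots> = a" using a by (simp add: tree_fugacity_def)
  finally have key: "ta * PP * (s + S - a) \<le> a" by (simp add: s_def algebra_simps)
  have pa: "?p * (s + S) \<le> a"
  proof (cases "s + S - a \<ge> 0")
    case True
    have "?p * (s + S - a) \<le> ta * PP * (1 - ?p) * (s + S - a)"
      using odds True by (rule mult_right_mono)
    also have "\<dots> = (ta * PP * (s + S - a)) * (1 - ?p)" by simp
    also have "\<dots> \<le> a * (1 - ?p)" using key p by (intro mult_right_mono) auto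
    finally show ?thesis by (simp add: algebra_simps)
  next
    \<comment> \<open>Here \<open>s + S < a\<close>, so \<open>?p < 1\<close> alone
      suffices.\<close>
    case False
    then have "?p * (s + S) \<le> ?p * a" using p by (intro mult_left_mono) auto
    also have "\<dots> \<le> 1 * a" using p a by (intro mult_right_mono) auto
    finally show ?thesis by simp
  qed
  have "?p * (1 + infl ta U w) \<le> ?p * (1 + S / s)"
    using q(3) p by (intro mult_left_mono) (auto simp: S_def)
  also have "\<dots> = ?p * (s + S) / s" using s by (simp add: field_simps)
  also have "\<dots> \<le> min ?p a / s"
  proof (rule divide_right_mono)
    have "?p * (s + S) \<le> ?p * 1" using S p by (intro mult_left_mono) (auto simp: s_def)
    then show "?p * (s + S) \<le> min ?p a" using pa by simp
  qed (use s in simp)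
  finally show ?case by (simp add: s_def)
qed

text \<open>The starting vertex may have all \<open>d + 1\<close> neighbours; each of them satisfies
  \<open>cavity_bound\<close> and contributes at most \<open>a\<close> to the sum of the
  \<open>q x\<close>.\<close>

lemma infl_bound:
  assumes "U \<subseteq> V" "\<And>v. card (nb v) \<le> d + 1" "w \<in> U"
  shows "1 + infl ta U w \<le> (1 + a) / (1 - real d * a)"
proof -
  have card: "card (nb w \<inter> U) \<le> d + 1"
    using card_mono[OF finite_nb, of "nb w \<inter> U" w] assms(2)[of w] by simp
  have "marg ta U' x * (1 + infl ta U' x) \<le> min (marg ta U' x) a / (1 - real d * a)"
    if U': "U' \<subseteq> U - {w}" "x \<in> U'" "x \<in> nb w" for U' x
  proof (rule cavity_bound)
    show "U' \<subseteq> V" "x \<in> U'" using U' assms by auto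
    show "card (nb v) \<le> d + 1" for v by (rule assms(2))
    have "nb x \<inter> U' \<subset> nb x" using U' nb_sym by blast
    then have "card (nb x \<inter> U') < card (nb x)" using finite_nb by (rule psubset_card_mono[rotated])
    then show "card (nb x \<inter> U') \<le> d" using assms(2)[of x] by simp
  qed
  then have "\<forall>U' x. U' \<subseteq> U - {w} \<and> x \<in> U' \<and> x \<in> nb w \<longrightarrow>
      marg ta U' x * (1 + infl ta U' x) \<le> min (marg ta U' x) a / (1 - real d * a)"
    by blast
  from infl_le_of_bound[OF assms(1,3) this]
  obtain q where q: "\<forall>x\<in>nb w \<inter> U. q x \<le> a \<and> q x < 1"
    "infl ta U w \<le> (\<Sum>x\<in>nb w \<inter> U. q x) / (1 - real d * a)"
    by (elim exE conjE)
  have "(\<Sum>x\<in>nb w \<inter> U. q x) \<le> real (card (nb w \<inter> U)) * a"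
    using q(1) by (intro sum_bounded_above) auto
  also have "\<dots> \<le> real (d + 1) * a" using card a by (intro mult_right_mono) auto
  finally have "(\<Sum>x\<in>nb w \<inter> U. q x) / (1 - real d * a) \<le> real (d + 1) * a / (1 - real d * a)"
    using a by (intro divide_right_mono) auto
  then have "1 + infl ta U w \<le> 1 + real (d + 1) * a / (1 - real d * a)" using q(2) by linarith
  also have "\<dots> = (1 + a) / (1 - real d * a)" using a by (simp add: field_simps)
  finally show ?thesis .
qed

end

end

section \<open>Spectral independence\<close>

text \<open>A bound on the rows of the covariance matrix of the \<open>X v\<close> passes to its
  quadratic form by Schur's test, and by duality to covariances with an arbitrary \<open>f\<close>:
  the square of \<open>\<eta> * (f - F) - g\<close> has nonnegative mean, where \<open>g\<close>
  combines the centred \<open>X v\<close> with coefficients \<open>k v / e v\<close>.\<close>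

lemma weighted_spectral_bound:
  fixes m :: "'b \<Rightarrow> real" and X :: "'v \<Rightarrow> 'b \<Rightarrow> real"
  assumes "\<And>x. x \<in> \<Omega> \<Longrightarrow> m x \<ge> 0" "(\<Sum>x\<in>\<Omega>. m x) = 1" "\<eta> > 0"
    and e: "\<And>v. v \<in> A \<Longrightarrow> e v = (\<Sum>x\<in>\<Omega>. m x * X v x)" "\<And>v. v \<in> A \<Longrightarrow> e v > 0"
    and row: "\<And>u. u \<in> A \<Longrightarrow> (\<Sum>v\<in>A. \<bar>(\<Sum>x\<in>\<Omega>. m x * (X u x * X v x)) - e u * e v\<bar>) \<le> \<eta> * e u"
  shows "(\<Sum>v\<in>A. ((\<Sum>x\<in>\<Omega>. m x * (X v x * f x)) - e v * (\<Sum>x\<in>\<Omega>. m x * f x))\<^sup>2 / e v)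
    \<le> \<eta> * ((\<Sum>x\<in>\<Omega>. m x * (f x)\<^sup>2) - (\<Sum>x\<in>\<Omega>. m x * f x)\<^sup>2)"
proof -
  define F where "F = (\<Sum>x\<in>\<Omega>. m x * f x)"
  define F2 where "F2 = (\<Sum>x\<in>\<Omega>. m x * (f x)\<^sup>2)"
  \<comment> \<open>\<open>k v\<close> is the covariance of \<open>f\<close> and \<open>X v\<close>,
    \<open>c u v\<close> that of \<open>X u\<close> and \<open>X v\<close>, and \<open>Q\<close> is
    the left-hand side of the claim.\<close>
  define k where "k v = (\<Sum>x\<in>\<Omega>. m x * (X v x * f x)) - e v * F" for v
  define c where "c u v = (\<Sum>x\<in>\<Omega>. m x * (X u x * X v x)) - e u * e v" for u v
  define y where "y v = k v / e v" for v
  define Q where "Q = (\<Sum>v\<in>A. y v * k v)"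
  define g where "g x = (\<Sum>v\<in>A. y v * (X v x - e v))" for x
  have csym: "c u v = c v u" for u v by (simp add: c_def mult.commute)
  have cov_fX: "(\<Sum>x\<in>\<Omega>. m x * ((f x - F) * (X v x - e v))) = k v" if "v \<in> A" for v
  proof -
    have "(\<Sum>x\<in>\<Omega>. m x * ((f x - F) * (X v x - e v)))
        = (\<Sum>x\<in>\<Omega>. m x * (X v x * f x)) - e v * (\<Sum>x\<in>\<Omega>. m x * f x)
          - F * (\<Sum>x\<in>\<Omega>. m x * X v x) + F * e v * (\<Sum>x\<in>\<Omega>. m x)"
      by (simp add: sum_distrib_left sum_subtractf[symmetric] sum.distrib[symmetric])
        (rule sum.cong, auto simp: algebra_simps)
    then show ?thesis using that assms(2) by (simp add: e(1)[symmetric] k_def F_def)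
  qed
  have cov_XX: "(\<Sum>x\<in>\<Omega>. m x * ((X u x - e u) * (X v x - e v))) = c u v" if "u \<in> A" "v \<in> A" for u v
  proof -
    have "(\<Sum>x\<in>\<Omega>. m x * ((X u x - e u) * (X v x - e v)))
        = (\<Sum>x\<in>\<Omega>. m x * (X u x * X v x)) - e v * (\<Sum>x\<in>\<Omega>. m x * X u x)
          - e u * (\<Sum>x\<in>\<Omega>. m x * X v x) + e u * e v * (\<Sum>x\<in>\<Omega>. m x)"
      by (simp add: sum_distrib_left sum_subtractf[symmetric] sum.distrib[symmetric])
        (rule sum.cong, auto simp: algebra_simps)
    then show ?thesis using that assms(2) by (simp add: e(1)[symmetric] c_def)
  qed
  have var: "(\<Sum>x\<in>\<Omega>. m x * (f x - F)\<^sup>2) = F2 - F\<^sup>2"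
  proof -
    have "(\<Sum>x\<in>\<Omega>. m x * (f x - F)\<^sup>2)
        = F2 - 2 * F * (\<Sum>x\<in>\<Omega>. m x * f x) + F\<^sup>2 * (\<Sum>x\<in>\<Omega>. m x)"
      by (simp add: F2_def sum_distrib_left sum_subtractf[symmetric] sum.distrib[symmetric])
        (rule sum.cong, auto simp: algebra_simps power2_eq_square)
    then show ?thesis using assms(2) by (simp add: F_def power2_eq_square)
  qed
  have fg: "(\<Sum>x\<in>\<Omega>. m x * ((f x - F) * g x)) = Q"
  proof -
    have "(\<Sum>x\<in>\<Omega>. m x * ((f x - F) * g x))
        = (\<Sum>x\<in>\<Omega>. \<Sum>v\<in>A. y v * (m x * ((f x - F) * (X v x - e v))))"
      by (simp add: g_def sum_distrib_left mult_ac)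
    also have "\<dots> = (\<Sum>v\<in>A. \<Sum>x\<in>\<Omega>. y v * (m x * ((f x - F) * (X v x - e v))))"
      by (rule sum.swap)
    also have "\<dots> = Q" by (simp add: sum_distrib_left[symmetric] cov_fX Q_def)
    finally show ?thesis .
  qed
  have gg: "(\<Sum>x\<in>\<Omega>. m x * (g x)\<^sup>2) = (\<Sum>u\<in>A. \<Sum>v\<in>A. y u * y v * c u v)"
  proof -
    have "(\<Sum>x\<in>\<Omega>. m x * (g x)\<^sup>2)
        = (\<Sum>x\<in>\<Omega>. \<Sum>u\<in>A. \<Sum>v\<in>A. y u * y v * (m x * ((X u x - e u) * (X v x - e v))))"
      by (simp add: g_def power2_eq_square sum_product sum_distrib_left mult_ac)
    also have "\<dots> = (\<Sum>u\<in>A. \<Sum>x\<in>\<Omega>. \<Sum>v\<in>A. y u * y v * (m x * ((X u x - e u) * (X v x - e v))))"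
      by (rule sum.swap)
    also have "\<dots> = (\<Sum>u\<in>A. \<Sum>v\<in>A. \<Sum>x\<in>\<Omega>. y u * y v * (m x * ((X u x - e u) * (X v x - e v))))"
      by (rule sum.cong[OF refl], rule sum.swap)
    also have "\<dots> = (\<Sum>u\<in>A. \<Sum>v\<in>A. y u * y v * c u v)"
      by (intro sum.cong refl) (simp add: sum_distrib_left[symmetric] cov_XX)
    finally show ?thesis .
  qed
  \<comment> \<open>Schur's test: \<open>y u * y v\<close> is at most the mean of the two squares,
    and the symmetry of \<open>c\<close> turns column sums into row sums.\<close>
  have "(\<Sum>u\<in>A. \<Sum>v\<in>A. y u * y v * c u v)
      \<le> (\<Sum>u\<in>A. \<Sum>v\<in>A. (y u)\<^sup>2 * \<bar>c u v\<bar> / 2 + (y v)\<^sup>2 * \<bar>c v u\<bar> / 2)"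
  proof (intro sum_mono)
    fix u v
    have "y u * y v * c u v \<le> \<bar>y u * y v\<bar> * \<bar>c u v\<bar>" by (metis abs_ge_self abs_mult)
    also have "\<dots> \<le> (((y u)\<^sup>2 + (y v)\<^sup>2) / 2) * \<bar>c u v\<bar>"
    proof (rule mult_right_mono)
      have "0 \<le> (\<bar>y u\<bar> - \<bar>y v\<bar>)\<^sup>2" by simp
      then show "\<bar>y u * y v\<bar> \<le> ((y u)\<^sup>2 + (y v)\<^sup>2) / 2"
        by (simp add: power2_diff abs_mult)
    qed simp
    finally show "y u * y v * c u v \<le> (y u)\<^sup>2 * \<bar>c u v\<bar> / 2 + (y v)\<^sup>2 * \<bar>c v u\<bar> / 2"
      unfolding csym[of v u] by (simp add: field_simps)
  qed
  also have "\<dots> = (\<Sum>u\<in>A. \<Sum>v\<in>A. (y u)\<^sup>2 * \<bar>c u v\<bar> / 2) + (\<Sum>v\<in>A. \<Sum>u\<in>A. (y v)\<^sup>2 * \<bar>c v u\<bar> / 2)"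
    by (simp add: sum.distrib sum.swap[of "\<lambda>u v. (y v)\<^sup>2 * \<bar>c v u\<bar> / 2" A A])
  also have "\<dots> = (\<Sum>u\<in>A. \<Sum>v\<in>A. (y u)\<^sup>2 * \<bar>c u v\<bar>)"
    by (simp add: sum.distrib[symmetric] mult.commute)
  also have "\<dots> \<le> (\<Sum>u\<in>A. (y u)\<^sup>2 * (\<eta> * e u))"
    unfolding sum_distrib_left[symmetric]
    by (intro sum_mono mult_left_mono) (use row in \<open>auto simp: c_def\<close>)
  also have "\<dots> = \<eta> * Q"
    unfolding Q_def sum_distrib_left
    by (rule sum.cong[OF refl]) (use e(2) in \<open>fastforce simp: y_def power2_eq_square\<close>)
  finally have gg_le: "(\<Sum>x\<in>\<Omega>. m x * (g x)\<^sup>2) \<le> \<eta> * Q" by (simp add: gg)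
  \<comment> \<open>The factor \<open>\<eta>\<close> makes the cross term
    \<open>- 2 * \<eta> * Q\<close> outweigh the bound \<open>\<eta> * Q\<close> on the last
    term.\<close>
  have "0 \<le> (\<Sum>x\<in>\<Omega>. m x * (\<eta> * (f x - F) - g x)\<^sup>2)"
    using assms(1) by (intro sum_nonneg) auto
  also have "\<dots> = \<eta>\<^sup>2 * (\<Sum>x\<in>\<Omega>. m x * (f x - F)\<^sup>2) - 2 * \<eta> * (\<Sum>x\<in>\<Omega>. m x * ((f x - F) * g x))
      + (\<Sum>x\<in>\<Omega>. m x * (g x)\<^sup>2)"
    by (simp add: sum_distrib_left sum_subtractf[symmetric] sum.distrib[symmetric])
      (rule sum.cong, auto simp: algebra_simps power2_eq_square)
  also have "\<dots> \<le> \<eta>\<^sup>2 * (F2 - F\<^sup>2) - 2 * \<eta> * Q + \<eta> * Q"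
    unfolding var fg using gg_le by linarith
  finally have "\<eta> * Q \<le> \<eta> * (\<eta> * (F2 - F\<^sup>2))" by (simp add: power2_eq_square algebra_simps)
  then have "Q \<le> \<eta> * (F2 - F\<^sup>2)" using assms(3) by (rule mult_left_le_imp_le)
  moreover have "(\<Sum>v\<in>A. (k v)\<^sup>2 / e v) = Q"
    by (simp add: Q_def y_def power2_eq_square)
  ultimately show ?thesis by (simp add: k_def F_def F2_def)
qed

context finite_graph
begin

section \<open>Covariances of occupation indicators\<close>

lemma ev_mem_mem:
  assumes "finite U" "u \<in> U" "t \<ge> 0"
  shows "ev t U (\<lambda>S. of_bool (u \<in> S) * of_bool (v \<in> S))
    = marg t U u * (of_bool (v = u) + marg t (U - insert u (nb u)) v)"
proof -
  have "Z t (U - insert u (nb u)) > 0" using Z_ge_1[of "U - insert u (nb u)" t] assms by auto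
  then show ?thesis
    unfolding ev_mem_insert[OF assms, symmetric] marg_eq[OF assms(1,2)]
    by (simp add: ev_def wsum_mem[OF assms(1,2)])
qed

lemma ev_bounds:
  assumes "finite U" "t \<ge> 0" "\<And>S. S \<in> ind U \<Longrightarrow> 0 \<le> f S" "\<And>S. S \<in> ind U \<Longrightarrow> f S \<le> 1"
  shows "0 \<le> ev t U f" "ev t U f \<le> 1"
proof -
  have Z: "Z t U > 0" using Z_ge_1[OF assms(1,2)] by simp
  show "0 \<le> ev t U f"
    unfolding ev_def using wsum_nonneg[OF assms(2,3)] Z by simp
  have "wsum t U f \<le> Z t U"
    unfolding wsum_def using assms by (intro sum_mono mult_left_mono) auto
  then show "ev t U f \<le> 1" using Z by (simp add: ev_def)
qed

text \<open>The row of \<open>u\<close> in the covariance matrix of the occupation indicators,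
  divided by the marginal of \<open>u\<close>. All induced subgraphs are covered at once because
  revealing occupied vertices leaves such a subgraph.\<close>

definition cov_row_bound :: "real \<Rightarrow> real \<Rightarrow> bool" where
  "cov_row_bound t \<eta> \<longleftrightarrow> (\<forall>U u. U \<subseteq> V \<longrightarrow> u \<in> U \<longrightarrow>
     (\<Sum>v\<in>U. \<bar>of_bool (v = u) + marg t (U - insert u (nb u)) v - marg t U v\<bar>) \<le> \<eta>)"

lemma cov_row_bound_card:
  assumes "t \<ge> 0"
  shows "cov_row_bound t (real (card V))"
  unfolding cov_row_bound_def
proof (intro allI impI)
  fix U u assume U: "U \<subseteq> V" "u \<in> U"
  then have fU: "finite U" using finite_V finite_subset by blast
  have "(\<Sum>v\<in>U. \<bar>of_bool (v = u) + marg t (U - insert u (nb u)) v - marg t U v\<bar>)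
      \<le> (\<Sum>v\<in>U. 1)"
  proof (rule sum_mono)
    fix v
    have "0 \<le> marg t U v" "marg t U v \<le> 1"
      unfolding marg_def using ev_bounds[OF fU assms, of "\<lambda>S. of_bool (v \<in> S)"] by auto
    moreover have "0 \<le> ev t (U - insert u (nb u)) (\<lambda>S. of_bool (v \<in> insert u S))"
      "ev t (U - insert u (nb u)) (\<lambda>S. of_bool (v \<in> insert u S)) \<le> 1"
      by (rule ev_bounds; use fU assms in auto)+
    ultimately show "\<bar>of_bool (v = u) + marg t (U - insert u (nb u)) v - marg t U v\<bar> \<le> 1"
      unfolding ev_mem_insert[OF fU U(2) assms] by (simp only: abs_le_iff) linarith
  qed
  also have "\<dots> \<le> real (card V)" using card_mono[OF finite_V U(1)] by simp
  finally show "(\<Sum>v\<in>U. \<bar>of_bool (v = u) + marg t (U - insert u (nb u)) v - marg t U v\<bar>)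
      \<le> real (card V)" .
qed

text \<open>Relative to the unconditioned marginal, occupying \<open>u\<close> has only the fraction
  \<open>1 - marg t U u\<close> of the effect measured between occupied and vacant.\<close>

lemma cov_row_bound_infl:
  assumes "t \<ge> 0" "\<And>U u. U \<subseteq> V \<Longrightarrow> u \<in> U \<Longrightarrow> 1 + infl t U u \<le> \<eta>"
  shows "cov_row_bound t \<eta>"
  unfolding cov_row_bound_def
proof (intro allI impI)
  fix U u assume U: "U \<subseteq> V" "u \<in> U"
  then have fU: "finite U" using finite_V finite_subset by blast
  let ?x = "\<lambda>v. of_bool (v = u) + marg t (U - insert u (nb u)) v - marg t (U - {u}) v"
  have m: "0 \<le> marg t U u" "marg t U u \<le> 1"
    using marg_bounds[OF fU U(2) assms(1)] by auto
  have "\<bar>of_bool (v = u) + marg t (U - insert u (nb u)) v - marg t U v\<bar> \<le> \<bar>?x v\<bar>" for v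
  proof -
    have "of_bool (v = u) + marg t (U - insert u (nb u)) v - marg t U v = (1 - marg t U u) * ?x v"
      by (subst marg_split[OF fU U(2) assms(1), of v]) (simp add: algebra_simps)
    then have "\<bar>of_bool (v = u) + marg t (U - insert u (nb u)) v - marg t U v\<bar>
        = (1 - marg t U u) * \<bar>?x v\<bar>" using m by (simp add: abs_mult)
    also have "\<dots> \<le> 1 * \<bar>?x v\<bar>" using m by (intro mult_right_mono) auto
    finally show ?thesis by simp
  qed
  then have "(\<Sum>v\<in>U. \<bar>of_bool (v = u) + marg t (U - insert u (nb u)) v - marg t U v\<bar>)
      \<le> (\<Sum>v\<in>U. \<bar>?x v\<bar>)" by (rule sum_mono)
  also have "\<dots> \<le> (\<Sum>v\<in>V. \<bar>?x v\<bar>)" using finite_V U(1) by (intro sum_mono2) auto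
  also have "\<dots> \<le> 1 + infl t U u" using U by (intro sum_infl_le) auto
  also have "\<dots> \<le> \<eta>" using U by (rule assms(2))
  finally show "(\<Sum>v\<in>U. \<bar>of_bool (v = u) + marg t (U - insert u (nb u)) v - marg t U v\<bar>) \<le> \<eta>" .
qed

text \<open>\<open>weighted_spectral_bound\<close> for the occupation indicators under the hardcore
  measure, multiplied by \<open>Z t U\<close>. The difference in the square is the mean of
  \<open>f\<close> given that \<open>v\<close> is occupied, minus its mean.\<close>

lemma spectral_independence:
  assumes "cov_row_bound t \<eta>" "\<eta> > 0" "t > 0" "U \<subseteq> V"
  shows "t * (\<Sum>v\<in>U. Z t (U - insert v (nb v)) *
      (wsum t (U - insert v (nb v)) (\<lambda>S. f (insert v S)) / Z t (U - insert v (nb v))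
        - wsum t U f / Z t U)\<^sup>2)
    \<le> \<eta> * (wsum t U (\<lambda>S. (f S)\<^sup>2) - (wsum t U f)\<^sup>2 / Z t U)"
proof -
  have fU: "finite U" using assms(4) finite_V by (rule finite_subset)
  have t0: "t \<ge> 0" using assms(3) by simp
  define z where "z = Z t U"
  have z: "z > 0" using Z_ge_1[OF fU t0] by (simp add: z_def)
  have zv: "Z t (U - insert v (nb v)) > 0" for v
    using Z_ge_1[of "U - insert v (nb v)" t] fU t0 by auto
  let ?m = "\<lambda>S. t ^ card S / z"
  have ev: "(\<Sum>S\<in>ind U. ?m S * g S) = ev t U g" for g
    by (simp add: ev_def wsum_def z_def sum_divide_distrib)
  have "(\<Sum>v\<in>U. ((\<Sum>S\<in>ind U. ?m S * (of_bool (v \<in> S) * f S))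
        - marg t U v * (\<Sum>S\<in>ind U. ?m S * f S))\<^sup>2 / marg t U v)
      \<le> \<eta> * ((\<Sum>S\<in>ind U. ?m S * (f S)\<^sup>2) - (\<Sum>S\<in>ind U. ?m S * f S)\<^sup>2)"
  proof (rule weighted_spectral_bound)
    show "?m S \<ge> 0" for S using t0 z by simp
    have "(\<Sum>S\<in>ind U. ?m S) = ev t U (\<lambda>_. 1)" using ev[of "\<lambda>_. 1"] by simp
    then show "(\<Sum>S\<in>ind U. ?m S) = 1" using z by (simp add: ev_def z_def)
    show "marg t U v = (\<Sum>S\<in>ind U. ?m S * of_bool (v \<in> S))" for v
      by (simp only: ev marg_def)
    show "marg t U v > 0" if "v \<in> U" for v
      using z zv[of v] assms(3) by (simp add: marg_eq[OF fU that] z_def)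
    show "(\<Sum>v\<in>U. \<bar>(\<Sum>S\<in>ind U. ?m S * (of_bool (u \<in> S) * of_bool (v \<in> S))) - marg t U u * marg t U v\<bar>)
        \<le> \<eta> * marg t U u" if "u \<in> U" for u
    proof -
      have mu: "marg t U u \<ge> 0" using marg_bounds[OF fU that t0] by simp
      have "(\<Sum>v\<in>U. \<bar>(\<Sum>S\<in>ind U. ?m S * (of_bool (u \<in> S) * of_bool (v \<in> S))) - marg t U u * marg t U v\<bar>)
          = marg t U u * (\<Sum>v\<in>U. \<bar>of_bool (v = u) + marg t (U - insert u (nb u)) v - marg t U v\<bar>)"
        unfolding ev ev_mem_mem[OF fU that t0] right_diff_distrib[symmetric]
        using mu by (simp add: abs_mult sum_distrib_left)
      also have "\<dots> \<le> marg t U u * \<eta>"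
        using assms(1) that assms(4) mu by (intro mult_left_mono) (auto simp: cov_row_bound_def)
      finally show ?thesis by (simp add: mult.commute)
    qed
  qed fact
  then have main: "(\<Sum>v\<in>U. (ev t U (\<lambda>S. of_bool (v \<in> S) * f S) - marg t U v * ev t U f)\<^sup>2 / marg t U v)
      \<le> \<eta> * (ev t U (\<lambda>S. (f S)\<^sup>2) - (ev t U f)\<^sup>2)" by (simp only: ev)
  have "(\<Sum>v\<in>U. (ev t U (\<lambda>S. of_bool (v \<in> S) * f S) - marg t U v * ev t U f)\<^sup>2 / marg t U v)
    = (\<Sum>v\<in>U. t * (Z t (U - insert v (nb v)) *
      (wsum t (U - insert v (nb v)) (\<lambda>S. f (insert v S)) / Z t (U - insert v (nb v))
        - wsum t U f / Z t U)\<^sup>2) / z)"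
  proof (rule sum.cong[OF refl])
    fix v assume v: "v \<in> U"
    let ?y = "wsum t (U - insert v (nb v)) (\<lambda>S. f (insert v S))" and ?zv = "Z t (U - insert v (nb v))"
    have cov: "ev t U (\<lambda>S. of_bool (v \<in> S) * f S) - marg t U v * ev t U f
        = t * ?zv / z * (?y / ?zv - wsum t U f / z)"
      unfolding ev_def wsum_mem[OF fU v] marg_eq[OF fU v] z_def[symmetric]
      using z zv[of v] by (simp add: field_simps)
    have sq: "(c * D)\<^sup>2 / c = c * D\<^sup>2" for c D :: real
      by (simp add: power2_eq_square)
    show "(ev t U (\<lambda>S. of_bool (v \<in> S) * f S) - marg t U v * ev t U f)\<^sup>2 / marg t U v
        = t * (?zv * (?y / ?zv - wsum t U f / Z t U)\<^sup>2) / z"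
      unfolding cov unfolding marg_eq[OF fU v] z_def[symmetric] sq by simp
  qed
  also have "\<dots> = t * (\<Sum>v\<in>U. Z t (U - insert v (nb v)) *
      (wsum t (U - insert v (nb v)) (\<lambda>S. f (insert v S)) / Z t (U - insert v (nb v))
        - wsum t U f / Z t U)\<^sup>2) / z"
    by (simp add: sum_distrib_left sum_divide_distrib)
  finally have "t * (\<Sum>v\<in>U. Z t (U - insert v (nb v)) *
      (wsum t (U - insert v (nb v)) (\<lambda>S. f (insert v S)) / Z t (U - insert v (nb v))
        - wsum t U f / Z t U)\<^sup>2) / z \<le> \<eta> * (ev t U (\<lambda>S. (f S)\<^sup>2) - (ev t U f)\<^sup>2)"
    using main by simp
  also have "\<dots> = \<eta> * (wsum t U (\<lambda>S. (f S)\<^sup>2) - (wsum t U f)\<^sup>2 / Z t U) / z"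
    using z by (simp add: ev_def z_def[symmetric] power2_eq_square field_simps)
  finally show ?thesis using z by (simp add: divide_le_cancel)
qed

end

section \<open>Conditional variance along the fugacity\<close>

context finite_graph
begin

text \<open>Double counting of pairs of an independent set and one of its vertices, which is then
  removed. For the empty set, where \<open>card S - 1\<close> is truncated to 0, the factor
  \<open>card S\<close> vanishes.\<close>

lemma sum_card_ind:
  fixes h :: "nat \<Rightarrow> 'a set \<Rightarrow> real"
  assumes "finite U"
  shows "(\<Sum>S\<in>ind U. real (card S) * h (card S - 1) S)
    = (\<Sum>v\<in>U. \<Sum>S\<in>ind (U - insert v (nb v)). h (card S) (insert v S))"
proof -
  have "(\<Sum>S\<in>ind U. real (card S) * h (card S - 1) S)
      = (\<Sum>S\<in>ind U. \<Sum>v | v \<in> U \<and> v \<in> S. h (card S - 1) S)"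
  proof (rule sum.cong[OF refl])
    fix S assume "S \<in> ind U"
    then have "{v. v \<in> U \<and> v \<in> S} = S" by (auto simp: ind_iff)
    then show "real (card S) * h (card S - 1) S = (\<Sum>v | v \<in> U \<and> v \<in> S. h (card S - 1) S)"
      by simp
  qed
  also have "\<dots> = (\<Sum>v\<in>U. \<Sum>S | S \<in> ind U \<and> v \<in> S. h (card S - 1) S)"
    by (rule sum.swap_restrict) (use assms finite_ind in auto)
  also have "\<dots> = (\<Sum>v\<in>U. \<Sum>S\<in>ind (U - insert v (nb v)). h (card (insert v S) - 1) (insert v S))"
    by (rule sum.cong[OF refl]) (rule sum_ind_mem[OF assms])
  also have "\<dots> = (\<Sum>v\<in>U. \<Sum>S\<in>ind (U - insert v (nb v)). h (card S) (insert v S))"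
    by (intro sum.cong refl) (simp add: card_insert_rest[OF assms])
  finally show ?thesis .
qed

lemma wsum_has_derivative:
  assumes "finite U"
  shows "((\<lambda>t. wsum t U f) has_real_derivative
    (\<Sum>v\<in>U. wsum t (U - insert v (nb v)) (\<lambda>S. f (insert v S)))) (at t)"
proof -
  have "((\<lambda>t. wsum t U f) has_real_derivative
      (\<Sum>S\<in>ind U. real (card S) * (t ^ (card S - 1) * f S))) (at t)"
    unfolding wsum_def by (auto intro!: derivative_eq_intros sum.cong)
  then show ?thesis
    using sum_card_ind[OF assms, of "\<lambda>k S. t ^ k * f S"] by (simp add: wsum_def)
qed

section \<open>Residual graphs after part of a sample is revealed\<close>

definition avail :: "'a set \<Rightarrow> 'a set" where
  "avail R = V - R - (\<Union>x\<in>R. nb x)"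

lemma avail_subset: "avail R \<subseteq> V"
  by (auto simp: avail_def)

lemma finite_avail: "finite (avail R)"
  using avail_subset finite_V by (rule finite_subset)

lemma avail_insert: "avail (insert v R) = avail R - insert v (nb v)"
  by (auto simp: avail_def)

lemma avail_empty: "avail {} = V"
  by (simp add: avail_def)

lemma ind_avail: 
  assumes "v \<in> V"
  shows "{R \<in> ind V. v \<in> avail R} = ind (V - insert v (nb v))"
  by (rule set_eqI, unfold mem_Collect_eq ind_iff avail_def) (use assms nb_sym in blast)

definition shifted_sum :: "('a set \<Rightarrow> real) \<Rightarrow> 'a set \<Rightarrow> real \<Rightarrow> real" where
  "shifted_sum f R t = wsum t (avail R) (\<lambda>S. f (S \<union> R))"

lemma shifted_sum_insert:
  "wsum t (avail R - insert v (nb v)) (\<lambda>S. f (insert v S \<union> R)) = shifted_sum f (insert v R) t"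
  by (simp add: shifted_sum_def avail_insert)

text \<open>Differentiation in the fugacity adds one vertex to \<open>R\<close>, so the family over
  all \<open>R\<close> is closed under it.\<close>

lemma shifted_sum_has_derivative:
  "(shifted_sum f R has_real_derivative (\<Sum>v\<in>avail R. shifted_sum f (insert v R) t)) (at t)"
  using wsum_has_derivative[OF finite_avail, of R "\<lambda>S. f (S \<union> R)" t]
  by (simp only: shifted_sum_insert) (simp add: shifted_sum_def[abs_def])

lemma shifted_sum_pos: "t \<ge> 0 \<Longrightarrow> shifted_sum (\<lambda>_. 1) R t > 0"
  using Z_ge_1[OF finite_avail, of t R] by (simp add: shifted_sum_def)

lemma wsum_0: "finite U \<Longrightarrow> wsum 0 U f = f {}"
proof -
  assume U: "finite U"
  have "wsum 0 U f = (\<Sum>S\<in>{{}}. 0 ^ card S * f S)"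
    unfolding wsum_def
    by (rule sum.mono_neutral_right) (use U finite_ind empty_in_ind finite_mem_ind in \<open>auto simp: card_gt_0_iff\<close>)
  then show ?thesis by simp
qed

lemma shifted_sum_0: "shifted_sum f R 0 = f R"
  by (simp add: shifted_sum_def wsum_0[OF finite_avail])

text \<open>The variance of \<open>f (S \<union> R)\<close> for hardcore \<open>S\<close> on
  \<open>avail R\<close>, multiplied by the partition function.\<close>

definition scaled_var :: "('a set \<Rightarrow> real) \<Rightarrow> 'a set \<Rightarrow> real \<Rightarrow> real" where
  "scaled_var f R t = shifted_sum (\<lambda>S. (f S)\<^sup>2) R t - (shifted_sum f R t)\<^sup>2 / shifted_sum (\<lambda>_. 1) R t"

text \<open>Each summand is the squared change in the mean of \<open>f\<close> when \<open>v\<close>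
  joins \<open>R\<close>, weighted by the remaining partition function. Up to the factor
  \<open>t\<close> this is the left-hand side of \<open>spectral_independence\<close> on
  \<open>avail R\<close>.\<close>

definition scaled_var_drop :: "('a set \<Rightarrow> real) \<Rightarrow> 'a set \<Rightarrow> real \<Rightarrow> real" where
  "scaled_var_drop f R t = (\<Sum>v\<in>avail R. shifted_sum (\<lambda>_. 1) (insert v R) t *
     (shifted_sum f (insert v R) t / shifted_sum (\<lambda>_. 1) (insert v R) t
      - shifted_sum f R t / shifted_sum (\<lambda>_. 1) R t)\<^sup>2)"

text \<open>Up to the factor \<open>Z lam V\<close>: if \<open>R\<close> keeps every vertex of a hardcore sample at fugacity
  \<open>lam\<close> independently with probability \<open>1 - t / lam\<close>, then the rest of the sample is hardcore
  on \<open>avail R\<close> at fugacity \<open>t\<close>, and this is the expected conditional variance given \<open>R\<close>.\<close>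

definition residual_var :: "real \<Rightarrow> ('a set \<Rightarrow> real) \<Rightarrow> real \<Rightarrow> real" where
  "residual_var lam f t = (\<Sum>R\<in>ind V. (lam - t) ^ card R * scaled_var f R t)"

definition residual_var_drop :: "real \<Rightarrow> ('a set \<Rightarrow> real) \<Rightarrow> real \<Rightarrow> real" where
  "residual_var_drop lam f t = (\<Sum>R\<in>ind V. (lam - t) ^ card R * scaled_var_drop f R t)"

text \<open>For each \<open>v\<close> the quotient rule yields the scaled variance of
  \<open>insert v R\<close> and a remainder, which is a complete square: the summand of
  \<open>scaled_var_drop\<close>.\<close>

lemma scaled_var_has_derivative:
  assumes "t \<ge> 0"
  shows "(scaled_var f R has_real_derivative
    scaled_var_drop f R t + (\<Sum>v\<in>avail R. scaled_var f (insert v R) t)) (at t)"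
proof -
  let ?A = "shifted_sum f" and ?B = "shifted_sum (\<lambda>S. (f S)\<^sup>2)" and ?Z = "shifted_sum (\<lambda>_. 1)"
  have Z: "?Z R' t > 0" for R' using shifted_sum_pos[OF assms] .
  have "(scaled_var f R has_real_derivative (\<Sum>v\<in>avail R. ?B (insert v R) t)
     - (2 * ?A R t * (\<Sum>v\<in>avail R. ?A (insert v R) t) * ?Z R t
         - (?A R t)\<^sup>2 * (\<Sum>v\<in>avail R. ?Z (insert v R) t)) / (?Z R t * ?Z R t)) (at t)"
    unfolding scaled_var_def[abs_def]
    by (rule derivative_eq_intros shifted_sum_has_derivative refl | use Z[of R] in simp)+
  moreover have "(\<Sum>v\<in>avail R. ?B (insert v R) t)
     - (2 * ?A R t * (\<Sum>v\<in>avail R. ?A (insert v R) t) * ?Z R t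
         - (?A R t)\<^sup>2 * (\<Sum>v\<in>avail R. ?Z (insert v R) t)) / (?Z R t * ?Z R t)
     = (\<Sum>v\<in>avail R. ?B (insert v R) t
     - (2 * ?A R t * ?A (insert v R) t * ?Z R t
         - (?A R t)\<^sup>2 * ?Z (insert v R) t) / (?Z R t * ?Z R t))"
    by (simp add: sum_subtractf sum_distrib_left sum_distrib_right sum_divide_distrib
        diff_divide_distrib)
  moreover have "\<dots> = scaled_var_drop f R t + (\<Sum>v\<in>avail R. scaled_var f (insert v R) t)"
    unfolding scaled_var_drop_def scaled_var_def sum.distrib[symmetric]
  proof (rule sum.cong[OF refl])
    fix v
    have *: "B - (2 * A * Av * z - A\<^sup>2 * zv) / (z * z) = zv * (Av / zv - A / z)\<^sup>2 + (B - Av\<^sup>2 / zv)"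
      if "z > 0" "zv > 0" for A Av B z zv :: real
      using that by (simp add: field_simps power2_eq_square)
    show "?B (insert v R) t - (2 * ?A R t * ?A (insert v R) t * ?Z R t
         - (?A R t)\<^sup>2 * ?Z (insert v R) t) / (?Z R t * ?Z R t)
      = ?Z (insert v R) t * (?A (insert v R) t / ?Z (insert v R) t - ?A R t / ?Z R t)\<^sup>2
        + (?B (insert v R) t - (?A (insert v R) t)\<^sup>2 / ?Z (insert v R) t)"
      by (rule *[OF Z Z])
  qed
  ultimately show ?thesis by simp
qed

section \<open>Double counting of revealed sets and their extensions by one vertex\<close>

lemma sum_ind_avail_swap:
  fixes h :: "'a \<Rightarrow> 'a set \<Rightarrow> real"
  shows "(\<Sum>R\<in>ind V. \<Sum>v\<in>avail R. h v R) = (\<Sum>v\<in>V. \<Sum>R\<in>ind (V - insert v (nb v)). h v R)"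
proof -
  have "(\<Sum>R\<in>ind V. \<Sum>v\<in>avail R. h v R) = (\<Sum>R\<in>ind V. \<Sum>v | v \<in> V \<and> v \<in> avail R. h v R)"
    by (intro sum.cong refl) (use avail_subset in auto)
  also have "\<dots> = (\<Sum>v\<in>V. \<Sum>R | R \<in> ind V \<and> v \<in> avail R. h v R)"
    by (rule sum.swap_restrict) (use finite_V finite_ind in auto)
  also have "\<dots> = (\<Sum>v\<in>V. \<Sum>R\<in>ind (V - insert v (nb v)). h v R)"
    by (rule sum.cong[OF refl]) (simp add: ind_avail)
  finally show ?thesis .
qed

lemma sum_ind_avail:
  fixes h :: "nat \<Rightarrow> 'a set \<Rightarrow> real"
  shows "(\<Sum>R\<in>ind V. \<Sum>v\<in>avail R. h (card R) (insert v R))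
    = (\<Sum>R\<in>ind V. real (card R) * h (card R - 1) R)"
  unfolding sum_ind_avail_swap by (rule sum_card_ind[OF finite_V, symmetric])

text \<open>By \<open>sum_ind_avail\<close> the terms for enlarged sets cancel the derivative of the
  weights \<open>(lam - t) ^ card R\<close>; only the squares remain.\<close>

lemma residual_var_has_derivative:
  assumes "t \<ge> 0"
  shows "(residual_var lam f has_real_derivative residual_var_drop lam f t) (at t)"
proof -
  have "(residual_var lam f has_real_derivative
      (\<Sum>R\<in>ind V. (lam - t) ^ card R
          * (scaled_var_drop f R t + (\<Sum>v\<in>avail R. scaled_var f (insert v R) t))
        - real (card R) * ((lam - t) ^ (card R - 1) * scaled_var f R t))) (at t)"
    unfolding residual_var_def[abs_def]
    by (rule derivative_eq_intros scaled_var_has_derivative[OF assms] refl | simp add: algebra_simps)+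
  also have "(\<Sum>R\<in>ind V. (lam - t) ^ card R
          * (scaled_var_drop f R t + (\<Sum>v\<in>avail R. scaled_var f (insert v R) t))
        - real (card R) * ((lam - t) ^ (card R - 1) * scaled_var f R t)) = residual_var_drop lam f t"
    using sum_ind_avail[of "\<lambda>k R. (lam - t) ^ k * scaled_var f R t"]
    by (simp add: residual_var_drop_def sum_subtractf distrib_left sum.distrib sum_distrib_left)
  finally show ?thesis .
qed

lemma residual_var_0: "residual_var lam f 0 = 0"
  by (simp add: residual_var_def scaled_var_def shifted_sum_0)

text \<open>At \<open>t = lam\<close> only \<open>R = {}\<close> has nonzero weight: nothing is
  revealed.\<close>

lemma residual_var_end:
  "residual_var lam f lam = wsum lam V (\<lambda>S. (f S)\<^sup>2) - (wsum lam V f)\<^sup>2 / Z lam V"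
proof -
  have "residual_var lam f lam = (\<Sum>R\<in>{{}}. (lam - lam) ^ card R * scaled_var f R lam)"
    unfolding residual_var_def
    by (rule sum.mono_neutral_right)
      (use finite_V finite_ind empty_in_ind finite_mem_ind in \<open>auto simp: card_gt_0_iff\<close>)
  then show ?thesis by (simp add: scaled_var_def shifted_sum_def avail_empty)
qed

lemma residual_var_drop_0:
  "residual_var_drop lam f 0
    = (\<Sum>R\<in>ind V. lam ^ card R * (\<Sum>v\<in>avail R. (f (insert v R) - f R)\<^sup>2))"
  by (simp add: residual_var_drop_def scaled_var_drop_def shifted_sum_0)

text \<open>Spectral independence on each \<open>avail R\<close> separately. In the variable
  \<open>ln t\<close> this bounds the logarithmic derivative of \<open>residual_var\<close> by
  \<open>\<eta>\<close>.\<close>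

lemma residual_var_drop_le:
  assumes "cov_row_bound t \<eta>" "\<eta> > 0" "t > 0" "t \<le> lam"
  shows "t * residual_var_drop lam f t \<le> \<eta> * residual_var lam f t"
proof -
  have "t * scaled_var_drop f R t \<le> \<eta> * scaled_var f R t" for R
    using spectral_independence[OF assms(1-3) avail_subset, of R "\<lambda>S. f (S \<union> R)"]
    unfolding scaled_var_drop_def scaled_var_def
    by (simp only: shifted_sum_insert) (simp add: shifted_sum_def avail_insert)
  then have "(\<Sum>R\<in>ind V. (lam - t) ^ card R * (t * scaled_var_drop f R t))
      \<le> (\<Sum>R\<in>ind V. (lam - t) ^ card R * (\<eta> * scaled_var f R t))"
    using assms(4) by (intro sum_mono mult_left_mono) auto
  then show ?thesis
    by (simp add: residual_var_def residual_var_drop_def sum_distrib_left mult.left_commute)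
qed

end

section \<open>Poincare inequality at the critical fugacity\<close>

lemma tree_fugacity_has_derivative:
  assumes "a < 1"
  shows "(tree_fugacity d has_real_derivative (1 + real d * a) / (1 - a) ^ (d + 2)) (at a)"
proof -
  have "((\<lambda>a. a / (1 - a) ^ (d + 1)) has_real_derivative
      (1 * (1 - a) ^ (d + 1) - a * (real (d + 1) * (1 - a) ^ d * (- 1)))
        / ((1 - a) ^ (d + 1) * (1 - a) ^ (d + 1))) (at a)"
    by (rule derivative_eq_intros refl | use assms in simp)+
  moreover have "(1 * (1 - a) ^ (d + 1) - a * (real (d + 1) * (1 - a) ^ d * (- 1)))
        / ((1 - a) ^ (d + 1) * (1 - a) ^ (d + 1)) = (1 + real d * a) / (1 - a) ^ (d + 2)"
    using assms by (simp add: divide_simps) (simp add: algebra_simps)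
  ultimately show ?thesis by (simp add: tree_fugacity_def[abs_def])
qed

lemma tree_fugacity_mono:
  assumes "0 \<le> a" "a \<le> b" "b < 1"
  shows "tree_fugacity d a \<le> tree_fugacity d b"
  unfolding tree_fugacity_def using assms by (intro frac_le power_mono) auto

context finite_graph
begin

context
  fixes d :: nat and lam :: real and f :: "'a set \<Rightarrow> real"
  assumes d: "d \<ge> 2" and deg: "\<And>v. card (nb v) \<le> d + 1"
    and lam: "lam = tree_fugacity d (1 / real d)"
begin

text \<open>Gronwall's argument in \<open>a\<close>: \<open>G\<close> is an antiderivative of the
  influence bound times the derivative of \<open>ln t\<close>, so \<open>\<phi>\<close> is
  nonincreasing. Near 0, \<open>exp (- G a)\<close> behaves like \<open>1 / a\<close>, so
  \<open>\<phi>\<close> tends to the derivative of the residual variance at 0.\<close>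

lemma residual_var_tree_le:
  assumes "0 < b" "real d * b < 1"
  shows "residual_var lam f (tree_fugacity d b)
    \<le> b * ((1 - b) / (1 - real d * b)) powr (2 * (real d + 1) / (real d - 1)) * residual_var_drop lam f 0"
proof -
  \<comment> \<open>\<open>K\<close> is read off from the partial fractions of the influence bound
    times the logarithmic derivative of \<open>tree_fugacity d a\<close>; the remaining term is
    \<open>1 / a\<close>.\<close>
  define K where "K = 2 * (real d + 1) / (real d - 1)"
  define U where "U a = residual_var lam f (tree_fugacity d a)" for a
  define G where "G a = ln a + K * (ln (1 - a) - ln (1 - real d * a))" for a
  define \<phi> where "\<phi> a = U a * exp (- G a)" for a
  have Kd: "K * (real d - 1) = 2 * (real d + 1)" using d by (simp add: K_def)
  have range: "a < 1" "real d * a < 1" "a \<le> 1 / real d" if "0 \<le> a" "a \<le> b" for a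
  proof -
    have "real d * a \<le> real d * b" using that by (intro mult_left_mono) auto
    then show da: "real d * a < 1" using assms by simp
    have "1 * a \<le> real d * a" using that d by (intro mult_right_mono) auto
    then show "a < 1" using da by simp
    show "a \<le> 1 / real d" using da d by (simp add: field_simps)
  qed
  have dU: "(U has_real_derivative
      residual_var_drop lam f (tree_fugacity d a) * ((1 + real d * a) / (1 - a) ^ (d + 2))) (at a)"
    if "0 \<le> a" "a \<le> b" for a
  proof -
    have "tree_fugacity d a \<ge> 0" using range[OF that] that by (simp add: tree_fugacity_def)
    then show ?thesis
      unfolding U_def[abs_def]
      by (intro DERIV_chain2[OF residual_var_has_derivative tree_fugacity_has_derivative])
        (use range[OF that] in auto)
  qed
  have dphi: "\<exists>y. (\<phi> has_real_derivative y) (at a) \<and> y \<le> 0" if a: "0 < a" "a \<le> b" for a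
  proof -
    have r: "a < 1" "real d * a < 1" "a \<le> 1 / real d" using range[of a] a by auto
    define U' where "U' = residual_var_drop lam f (tree_fugacity d a) * ((1 + real d * a) / (1 - a) ^ (d + 2))"
    define G' where "G' = 1 / a + K * ((-1) / (1 - a) - (- real d) / (1 - real d * a))"
    define t where "t = tree_fugacity d a"
    define \<eta> where "\<eta> = (1 + a) / (1 - real d * a)"
    have t: "t > 0" using a r by (simp add: t_def tree_fugacity_def)
    have tl: "t \<le> lam" unfolding t_def lam
      by (rule tree_fugacity_mono) (use a r d in auto)
    have eta: "\<eta> > 0" using a r by (simp add: \<eta>_def)
    have "cov_row_bound t \<eta>"
      unfolding t_def \<eta>_def
      by (rule cov_row_bound_infl) (use infl_bound[OF a(1) r(2,1)] deg t in \<open>auto simp: t_def\<close>)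
    then have drop: "t * residual_var_drop lam f t \<le> \<eta> * U a"
      using residual_var_drop_le[OF _ eta t tl] by (simp add: U_def t_def)
    have "G' = 1 / a + K * (real d - 1) / ((1 - a) * (1 - real d * a))"
      using a r by (simp add: G'_def field_simps)
    also have "\<dots> = ((1 - a) * (1 - real d * a) + 2 * (real d + 1) * a) / (a * ((1 - a) * (1 - real d * a)))"
      unfolding Kd using add_frac_eq[of a "(1 - a) * (1 - real d * a)" 1 "2 * (real d + 1)"] a r by simp
    also have "(1 - a) * (1 - real d * a) + 2 * (real d + 1) * a = (1 + a) * (1 + real d * a)"
      by (simp add: algebra_simps)
    also have "(1 + a) * (1 + real d * a) / (a * ((1 - a) * (1 - real d * a)))
        = \<eta> * ((1 + real d * a) / (a * (1 - a)))"
      by (simp add: \<eta>_def mult_ac)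
    finally have G': "G' = \<eta> * ((1 + real d * a) / (a * (1 - a)))" .
    have "U' = (t * residual_var_drop lam f t) * ((1 + real d * a) / (a * (1 - a)))"
      using a r by (simp add: U'_def t_def tree_fugacity_def)
    also have "\<dots> \<le> (\<eta> * U a) * ((1 + real d * a) / (a * (1 - a)))"
      using drop a r by (intro mult_right_mono) auto
    also have "\<dots> = G' * U a" by (simp add: G')
    finally have "(U' - G' * U a) * exp (- G a) \<le> 0"
      by (intro mult_nonpos_nonneg) auto
    moreover have dG: "(G has_real_derivative G') (at a)"
      unfolding G_def[abs_def] G'_def
      by (rule derivative_eq_intros refl | use a r in simp)+
    have "(\<phi> has_real_derivative U' * exp (- G a) + (exp (- G a) * (- G')) * U a) (at a)"
      unfolding \<phi>_def[abs_def] U'_def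
      by (intro DERIV_mult DERIV_chain2[OF DERIV_exp] DERIV_minus dG dU) (use a in auto)
    then have "(\<phi> has_real_derivative (U' - G' * U a) * exp (- G a)) (at a)"
      by (simp add: algebra_simps)
    ultimately show ?thesis by blast
  qed
  have mono: "\<phi> b \<le> \<phi> a" if "0 < a" "a \<le> b" for a
    by (rule DERIV_nonpos_imp_nonincreasing[OF that(2)]) (use dphi that in auto)
  \<comment> \<open>At 0 the derivative of \<open>tree_fugacity d\<close> is 1 and the residual
    variance vanishes.\<close>
  have "((\<lambda>a. (U a - U 0) / (a - 0)) \<longlongrightarrow> residual_var_drop lam f 0) (at 0)"
    using dU[of 0] assms by (simp add: has_field_derivative_iff tree_fugacity_def)
  then have "((\<lambda>a. U a / a) \<longlongrightarrow> residual_var_drop lam f 0) (at_right 0)"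
    by (auto simp: U_def tree_fugacity_def residual_var_0 intro: filterlim_mono at_le)
  moreover have "((\<lambda>a. exp (- (K * (ln (1 - a) - ln (1 - real d * a)))))
      \<longlongrightarrow> exp (- (K * (ln (1 - 0) - ln (1 - real d * 0))))) (at_right 0)"
    by (intro tendsto_intros) auto
  ultimately have limit: "((\<lambda>a. U a / a * exp (- (K * (ln (1 - a) - ln (1 - real d * a)))))
      \<longlongrightarrow> residual_var_drop lam f 0 * 1) (at_right 0)"
    by (intro tendsto_mult) auto
  have bound: "\<forall>\<^sub>F a in at_right 0. \<phi> b \<le> U a / a * exp (- (K * (ln (1 - a) - ln (1 - real d * a))))"
  proof -
    have "\<forall>\<^sub>F a in at_right 0. 0 < a \<and> a < b"
      using assms(1) by (auto simp: eventually_at_right_field)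
    then show ?thesis
    proof eventually_elim
      case (elim a)
      have "\<phi> a = U a / a * exp (- (K * (ln (1 - a) - ln (1 - real d * a))))"
        using elim by (simp add: \<phi>_def G_def exp_diff exp_minus exp_add field_simps)
      then show ?case using mono[of a] elim by simp
    qed
  qed
  have lim: "\<phi> b \<le> residual_var_drop lam f 0"
    using tendsto_lowerbound[OF limit bound] by simp
  have r: "b < 1" "real d * b < 1" using range[of b] assms by auto
  have expG: "exp (G b) = b * ((1 - b) / (1 - real d * b)) powr K"
    using assms r by (simp add: G_def exp_add powr_def ln_div)
  have "U b = \<phi> b * exp (G b)" by (simp add: \<phi>_def exp_minus)
  also have "\<dots> \<le> residual_var_drop lam f 0 * exp (G b)"
    using lim by (intro mult_right_mono) auto
  finally show ?thesis by (simp add: expG U_def K_def mult.commute)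
qed

text \<open>With the trivial bound \<open>card V\<close> on the covariance rows, the residual
  variance grows at most like \<open>t ^ card V\<close>.\<close>

lemma residual_var_power_le:
  assumes "0 < s" "s \<le> lam" "V \<noteq> {}"
  shows "residual_var lam f lam \<le> (lam / s) ^ card V * residual_var lam f s"
proof -
  define n where "n = card V"
  have n: "n > 0" using assms finite_V by (simp add: n_def card_gt_0_iff)
  have "residual_var lam f lam / lam ^ n \<le> residual_var lam f s / s ^ n"
  proof (rule DERIV_nonpos_imp_nonincreasing[OF assms(2)])
    fix t assume t: "s \<le> t" "t \<le> lam"
    then have t0: "t > 0" using assms by simp
    define W where "W = residual_var lam f t"
    define W' where "W' = residual_var_drop lam f t"
    have "t * W' \<le> real n * W"
      unfolding W_def W'_def n_def
      by (rule residual_var_drop_le) (use cov_row_bound_card n t t0 in \<open>auto simp: n_def\<close>)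
    then have "t ^ (n - 1) * (t * W' - real n * W) / (t ^ n * t ^ n) \<le> 0"
      using t0 by (intro divide_nonpos_pos mult_nonneg_nonpos) auto
    moreover have "t ^ (n - 1) * (t * W' - real n * W) = W' * t ^ n - W * (real n * t ^ (n - 1))"
      using n by (simp add: algebra_simps power_eq_if)
    moreover have "((\<lambda>t. residual_var lam f t / t ^ n) has_real_derivative
        (W' * t ^ n - W * (real n * t ^ (n - 1))) / (t ^ n * t ^ n)) (at t)"
      unfolding W_def W'_def
      by (rule derivative_eq_intros residual_var_has_derivative refl | use t0 in simp)+
    ultimately show "\<exists>y. ((\<lambda>t. residual_var lam f t / t ^ n) has_real_derivative y) (at t) \<and> y \<le> 0"
      by auto
  qed
  then show ?thesis
    using assms by (simp add: n_def power_divide field_simps)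
qed

text \<open>Serves to exchange the factor \<open>1 / d\<close> left by the tree bound for the weight
  \<open>lam / (1 + lam)\<close> of the Dirichlet form; it comes down to
  \<open>1 / (d - 1) \<le> lam\<close>.\<close>

lemma lam_bounds: "1 / real d \<le> lam / (1 + lam)" "lam > 0"
proof -
  have "(1 - 1 / real d) ^ (d + 1) \<le> (1 - 1 / real d) ^ 1"
    using d by (intro power_decreasing) auto
  moreover have "(1 - 1 / real d) ^ (d + 1) > 0" using d by simp
  ultimately have "(1 / real d) / (1 - 1 / real d) \<le> lam"
    unfolding lam tree_fugacity_def using d by (intro divide_left_mono) auto
  then have *: "1 / (real d - 1) \<le> lam" using d by (simp add: field_simps)
  moreover have "1 / (real d - 1) > 0" using d by simp
  ultimately show "lam > 0" by linarith
  then show "1 / real d \<le> lam / (1 + lam)" using * d by (simp add: field_simps)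
qed

text \<open>The tree bound is used up to the fugacity \<open>s\<close> and the trivial bound from
  \<open>s\<close> to \<open>lam\<close>, because the tree bound blows up as
  \<open>1 - d * a\<close> tends to 0.\<close>

lemma poincare:
  assumes n: "card V = n" "n \<ge> 2"
  shows "wsum lam V (\<lambda>S. (f S)\<^sup>2) - (wsum lam V f)\<^sup>2 / Z lam V
    \<le> exp 5 * real n powr (2 * (real d + 1) / (real d - 1)) *
      (lam / (1 + lam) * (\<Sum>R\<in>ind V. lam ^ card R * (\<Sum>v\<in>avail R. (f (insert v R) - f R)\<^sup>2)))"
proof -
  define K where "K = 2 * (real d + 1) / (real d - 1)"
  have K: "K \<ge> 0" using d by (simp add: K_def)
  define J where "J = residual_var_drop lam f 0"
  have J0: "J \<ge> 0"
    unfolding J_def residual_var_drop_0 using lam_bounds(2)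
    by (intro sum_nonneg mult_nonneg_nonneg) auto
  \<comment> \<open>Chosen to make \<open>1 - d * b = 1 / n\<close>, so that at \<open>s\<close> the
    tree bound on the influence is of order \<open>n\<close>, like the trivial one.\<close>
  define b where "b = (1 - 1 / real n) / real d"
  define s where "s = tree_fugacity d b"
  have db: "real d * b = 1 - 1 / real n" using d by (simp add: b_def)
  have b: "0 < b" "real d * b < 1" "b \<le> 1 / real d" "b < 1"
  proof -
    show "0 < b" "real d * b < 1" "b \<le> 1 / real d"
      using d n by (auto simp: b_def divide_right_mono)
    have "1 / real d < 1" using d by simp
    then show "b < 1" using \<open>b \<le> 1 / real d\<close> by linarith
  qed
  have s: "0 < s" "s \<le> lam"
  proof -
    show "0 < s" using b by (simp add: s_def tree_fugacity_def)
    show "s \<le> lam" unfolding s_def lam by (rule tree_fugacity_mono) (use b d in auto)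
  qed
  have V: "V \<noteq> {}" using n by auto
  \<comment> \<open>The ratio is \<open>1 + O(1 / n)\<close> uniformly in \<open>d\<close>, so its
    \<open>n\<close>-th power stays bounded.\<close>
  have "lam / s = 1 / (1 - 1 / real n) * ((1 - b) / (1 - 1 / real d)) ^ (d + 1)"
    unfolding lam s_def tree_fugacity_def power_divide b_def[symmetric] db[symmetric]
    using b d by (simp add: field_simps)
  also have "\<dots> \<le> exp (1 / (real n - 1)) * exp (1 / (real n * (real d - 1))) ^ (d + 1)"
  proof (intro mult_mono power_mono)
    have "1 / (1 - 1 / real n) = 1 + 1 / (real n - 1)" using n by (simp add: field_simps)
    then show "1 / (1 - 1 / real n) \<le> exp (1 / (real n - 1))"
      using exp_ge_add_one_self by metis
    have "(1 - b) / (1 - 1 / real d) = 1 + 1 / (real n * (real d - 1))"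
      using n d by (simp add: b_def field_simps)
    then show "(1 - b) / (1 - 1 / real d) \<le> exp (1 / (real n * (real d - 1)))"
      using exp_ge_add_one_self by metis
  qed (use b d n in auto)
  finally have ratio: "lam / s \<le> exp (1 / (real n - 1)) * exp (1 / (real n * (real d - 1))) ^ (d + 1)" .
  have "(lam / s) ^ n \<le> (exp (1 / (real n - 1)) * exp (1 / (real n * (real d - 1))) ^ (d + 1)) ^ n"
    using ratio s by (intro power_mono) auto
  also have "\<dots> = exp (real n / (real n - 1) + (real d + 1) / (real d - 1))"
  proof -
    have "real n * (1 / (real n - 1) + real (d + 1) * (1 / (real n * (real d - 1))))
        = real n / (real n - 1) + (real d + 1) / (real d - 1)"
    proof -
      have "real n \<noteq> 0" "real d - 1 \<noteq> 0" using n d by auto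
      then have "real n * (real (d + 1) * (1 / (real n * (real d - 1)))) = (real d + 1) / (real d - 1)"
        by (simp only: of_nat_add of_nat_1) (simp add: field_simps)
      then show ?thesis by (simp add: distrib_left)
    qed
    then show ?thesis by (simp only: exp_of_nat_mult[symmetric] exp_add[symmetric])
  qed
  \<comment> \<open>The two summands are largest at \<open>n = 2\<close> and \<open>d = 2\<close>,
    with values 2 and 3.\<close>
  also have "\<dots> \<le> exp 5"
  proof -
    have "real n / (real n - 1) \<le> 2" using n by (simp add: field_simps)
    moreover have "(real d + 1) / (real d - 1) \<le> 3" using d by (simp add: field_simps)
    ultimately show ?thesis by simp
  qed
  finally have e5: "(lam / s) ^ n \<le> exp 5" .
  have "residual_var lam f s \<le> b * ((1 - b) / (1 - real d * b)) powr K * J"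
    unfolding s_def K_def J_def by (rule residual_var_tree_le[OF b(1,2)])
  also have "\<dots> \<le> 1 / real d * real n powr K * J"
  proof (intro mult_right_mono mult_mono)
    show "((1 - b) / (1 - real d * b)) powr K \<le> real n powr K"
      using b n K unfolding db by (intro powr_mono2) (auto simp: field_simps)
  qed (use b J0 in auto)
  finally have rs: "residual_var lam f s \<le> 1 / real d * real n powr K * J" .
  have "residual_var lam f lam \<le> (lam / s) ^ n * residual_var lam f s"
    using residual_var_power_le[OF s V] n by simp
  also have "\<dots> \<le> (lam / s) ^ n * (1 / real d * real n powr K * J)"
    using rs s by (intro mult_left_mono) auto
  also have "\<dots> \<le> exp 5 * (lam / (1 + lam) * real n powr K * J)"
    using e5 J0 lam_bounds s by (intro mult_mono) auto
  finally show ?thesis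
    by (simp add: residual_var_end J_def residual_var_drop_0 K_def mult_ac)
qed

end

end

section \<open>Glauber dynamics\<close>

context finite_graph
begin

context
  fixes lam :: real
  assumes lam: "lam > 0" and V_ne: "V \<noteq> {}"
begin

text \<open>For independent \<open>\<sigma>\<close> and \<open>v \<in> V\<close>, the conditional
  expectation of \<open>f\<close> given the sample off \<open>v\<close>; the second case is a
  blocked \<open>v\<close>.\<close>

definition heat_bath :: "'a \<Rightarrow> ('a set \<Rightarrow> real) \<Rightarrow> 'a set \<Rightarrow> real" where
  "heat_bath v f \<sigma> = (if insert v \<sigma> \<in> ind V
     then (f (\<sigma> - {v}) + lam * f (insert v \<sigma>)) / (1 + lam) else f (\<sigma> - {v}))"

definition glauber_op :: "('a set \<Rightarrow> real) \<Rightarrow> 'a set \<Rightarrow> real" where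
  "glauber_op f \<sigma> = (\<Sum>v\<in>V. heat_bath v f \<sigma>) / real (card V)"

text \<open>\<open>card V\<close> times the Dirichlet form of the chain, in the unnormalised weights
  of \<open>wsum\<close>.\<close>

definition dirichlet :: "('a set \<Rightarrow> real) \<Rightarrow> real" where
  "dirichlet f = lam / (1 + lam) * (\<Sum>R\<in>ind V. lam ^ card R * (\<Sum>v\<in>avail R. (f (insert v R) - f R)\<^sup>2))"

text \<open>The independent sets split into pairs \<open>R\<close>, \<open>insert v R\<close> with
  \<open>v\<close> free, and single sets in which a neighbour blocks \<open>v\<close>. An update at
  \<open>v\<close> acts within these classes.\<close>

lemma wsum_pairs:
  assumes "v \<in> V"
  shows "wsum lam V g = (\<Sum>R\<in>ind (V - insert v (nb v)). lam ^ card R * (g R + lam * g (insert v R)))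
    + (\<Sum>R\<in>ind (V - {v}) - ind (V - insert v (nb v)). lam ^ card R * g R)"
proof -
  have sub: "ind (V - insert v (nb v)) \<subseteq> ind (V - {v})" by (auto simp: ind_iff)
  have "wsum lam (V - {v}) g = wsum lam (V - insert v (nb v)) g
      + (\<Sum>R\<in>ind (V - {v}) - ind (V - insert v (nb v)). lam ^ card R * g R)"
    unfolding wsum_def using finite_ind[of "V - {v}"] finite_V sub
    by (simp add: sum.subset_diff[of "ind (V - insert v (nb v))"])
  then show ?thesis
    using wsum_split[OF finite_V assms, of lam g]
    by (simp add: wsum_def sum_distrib_left distrib_left sum.distrib mult.left_commute)
qed

lemma heat_bath_free:
  assumes "v \<in> V" "R \<in> ind (V - insert v (nb v))"
  shows "heat_bath v f R = (f R + lam * f (insert v R)) / (1 + lam)"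
    "heat_bath v f (insert v R) = (f R + lam * f (insert v R)) / (1 + lam)"
proof -
  have "insert v R \<in> ind V" using assms ind_mem[OF assms(1)] by blast
  moreover have "R - {v} = R" "insert v R - {v} = R" using assms by (auto simp: ind_iff)
  ultimately show "heat_bath v f R = (f R + lam * f (insert v R)) / (1 + lam)"
    "heat_bath v f (insert v R) = (f R + lam * f (insert v R)) / (1 + lam)"
    by (simp_all add: heat_bath_def)
qed

lemma heat_bath_blocked:
  assumes "v \<in> V" "R \<in> ind (V - {v}) - ind (V - insert v (nb v))"
  shows "heat_bath v f R = f R"
proof -
  have "R - {v} = R" using assms by (auto simp: ind_iff)
  moreover have "insert v R \<notin> ind V"
    using assms unfolding insert_ind_iff by (auto simp: ind_iff)
  ultimately show ?thesis by (simp add: heat_bath_def)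
qed

lemma wsum_heat_bath:
  assumes "v \<in> V"
  shows "wsum lam V (\<lambda>\<sigma>. g \<sigma> * heat_bath v f \<sigma>) =
    (\<Sum>R\<in>ind (V - insert v (nb v)).
        lam ^ card R * ((g R + lam * g (insert v R)) * (f R + lam * f (insert v R)) / (1 + lam)))
    + (\<Sum>R\<in>ind (V - {v}) - ind (V - insert v (nb v)). lam ^ card R * (g R * f R))"
proof -
  have "x * (F / c) + lam * (y * (F / c)) = (x + lam * y) * F / c" for x y c F :: real
    by (simp add: distrib_right add_divide_distrib)
  then show ?thesis
    unfolding wsum_pairs[OF assms]
    by (intro arg_cong2[where f = "(+)"] sum.cong refl)
      (simp_all add: heat_bath_free[OF assms] heat_bath_blocked[OF assms])
qed

lemma heat_bath_sym:
  assumes "v \<in> V"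
  shows "wsum lam V (\<lambda>\<sigma>. g \<sigma> * heat_bath v f \<sigma>) = wsum lam V (\<lambda>\<sigma>. f \<sigma> * heat_bath v g \<sigma>)"
  unfolding wsum_heat_bath[OF assms] by (simp add: mult.commute)

text \<open>Together with \<open>heat_bath_sym\<close> this makes the update an orthogonal
  projection for the weighted inner product.\<close>

lemma heat_bath_idem:
  assumes "v \<in> V"
  shows "wsum lam V (\<lambda>\<sigma>. (heat_bath v f \<sigma>)\<^sup>2) = wsum lam V (\<lambda>\<sigma>. f \<sigma> * heat_bath v f \<sigma>)"
  unfolding power2_eq_square wsum_heat_bath[OF assms]
  by (intro arg_cong2[where f = "(+)"] sum.cong refl)
    (use lam in \<open>simp_all add: heat_bath_free[OF assms] heat_bath_blocked[OF assms] divide_simps\<close>,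
      simp add: algebra_simps)

text \<open>On a pair the loss is the scaled variance of a two-point distribution with weights 1 and
  \<open>lam\<close>; blocked sets lose nothing.\<close>

lemma heat_bath_loss:
  assumes "v \<in> V"
  shows "wsum lam V (\<lambda>\<sigma>. (f \<sigma>)\<^sup>2) - wsum lam V (\<lambda>\<sigma>. f \<sigma> * heat_bath v f \<sigma>)
    = (\<Sum>R\<in>ind (V - insert v (nb v)). lam / (1 + lam) * (lam ^ card R * (f (insert v R) - f R)\<^sup>2))"
proof -
  have "x\<^sup>2 + lam * y\<^sup>2 - (x + lam * y) * (x + lam * y) / (1 + lam) = lam / (1 + lam) * (y - x)\<^sup>2"
    for x y :: real
    using lam by (simp add: field_simps power2_eq_square)
  then have loss: "lam ^ k * (x\<^sup>2 + lam * y\<^sup>2) - lam ^ k * ((x + lam * y) * (x + lam * y) / (1 + lam))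
      = lam / (1 + lam) * (lam ^ k * (y - x)\<^sup>2)" for x y :: real and k :: nat
    unfolding right_diff_distrib[symmetric] by (metis mult.left_commute)
  have "(\<Sum>R\<in>B. lam ^ card R * (f R)\<^sup>2) = (\<Sum>R\<in>B. lam ^ card R * (f R * f R))" for B
    by (simp add: power2_eq_square)
  then show ?thesis
    unfolding wsum_heat_bath[OF assms] wsum_pairs[OF assms, of "\<lambda>\<sigma>. (f \<sigma>)\<^sup>2"]
    by (simp only: add_diff_cancel_right sum_subtractf[symmetric] loss)
qed

section \<open>The transition operator: reversibility, stationarity and contraction\<close>

lemma card_V_pos: "real (card V) > 0"
  using V_ne finite_V by (simp add: card_gt_0_iff)

lemma wsum_sum: "wsum t U (\<lambda>\<sigma>. \<Sum>v\<in>A. g v \<sigma>) = (\<Sum>v\<in>A. wsum t U (g v))"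
  unfolding wsum_def sum_distrib_left by (rule sum.swap)

lemma wsum_glauber_op:
  "wsum lam V (\<lambda>\<sigma>. g \<sigma> * glauber_op f \<sigma>)
    = (\<Sum>v\<in>V. wsum lam V (\<lambda>\<sigma>. g \<sigma> * heat_bath v f \<sigma>)) / real (card V)"
proof -
  have "wsum lam V (\<lambda>\<sigma>. g \<sigma> * glauber_op f \<sigma>)
      = wsum lam V (\<lambda>\<sigma>. 1 / real (card V) * (\<Sum>v\<in>V. g \<sigma> * heat_bath v f \<sigma>))"
    by (simp add: glauber_op_def sum_distrib_left sum_divide_distrib)
  then show ?thesis by (simp only: wsum_cmult wsum_sum) simp
qed

lemma glauber_op_sym:
  "wsum lam V (\<lambda>\<sigma>. g \<sigma> * glauber_op f \<sigma>) = wsum lam V (\<lambda>\<sigma>. f \<sigma> * glauber_op g \<sigma>)"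
  unfolding wsum_glauber_op by (simp add: heat_bath_sym[of _ g f] cong: sum.cong)

lemma glauber_op_one_plus: "glauber_op (\<lambda>\<sigma>. 1 + f \<sigma>) \<sigma> = 1 + glauber_op f \<sigma>"
proof -
  have "heat_bath v (\<lambda>\<sigma>. 1 + f \<sigma>) \<sigma> = 1 + heat_bath v f \<sigma>" for v
    using lam by (simp add: heat_bath_def field_simps)
  then show ?thesis using card_V_pos by (simp add: glauber_op_def sum.distrib add_divide_distrib)
qed

lemma wsum_glauber_op_mean: "wsum lam V (glauber_op f) = wsum lam V f"
proof -
  have "heat_bath v (\<lambda>_. 1) \<sigma> = 1" for v \<sigma> using lam by (simp add: heat_bath_def)
  then have "glauber_op (\<lambda>_. 1) \<sigma> = 1" for \<sigma> using card_V_pos by (simp add: glauber_op_def)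
  then show ?thesis using glauber_op_sym[of "\<lambda>_. 1" f] by simp
qed

text \<open>Jensen's inequality for the average over \<open>v\<close>, then
  \<open>heat_bath_idem\<close>. An average of projections has no negative spectrum, so the
  Dirichlet form alone controls the contraction.\<close>

lemma glauber_op_norm:
  "wsum lam V (\<lambda>\<sigma>. (glauber_op f \<sigma>)\<^sup>2) \<le> wsum lam V (\<lambda>\<sigma>. (f \<sigma>)\<^sup>2) - dirichlet f / real (card V)"
proof -
  let ?n = "real (card V)"
  have "(glauber_op f \<sigma>)\<^sup>2 \<le> 1 / ?n * (\<Sum>v\<in>V. (heat_bath v f \<sigma>)\<^sup>2)" for \<sigma>
  proof -
    have "(\<Sum>v\<in>V. heat_bath v f \<sigma>)\<^sup>2 \<le> (\<Sum>v\<in>V. (heat_bath v f \<sigma>)\<^sup>2) * ?n"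
      by (rule sum_squared_le_sum_of_squares)
    then show ?thesis
      using card_V_pos by (simp add: glauber_op_def power_divide power2_eq_square[of ?n] field_simps)
  qed
  then have "wsum lam V (\<lambda>\<sigma>. (glauber_op f \<sigma>)\<^sup>2) \<le> wsum lam V (\<lambda>\<sigma>. 1 / ?n * (\<Sum>v\<in>V. (heat_bath v f \<sigma>)\<^sup>2))"
    unfolding wsum_def using lam by (intro sum_mono mult_left_mono) auto
  also have "\<dots> = 1 / ?n * (\<Sum>v\<in>V. wsum lam V (\<lambda>\<sigma>. f \<sigma> * heat_bath v f \<sigma>))"
    by (simp only: wsum_cmult wsum_sum heat_bath_idem cong: sum.cong)
  also have "(\<Sum>v\<in>V. wsum lam V (\<lambda>\<sigma>. f \<sigma> * heat_bath v f \<sigma>))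
      = ?n * wsum lam V (\<lambda>\<sigma>. (f \<sigma>)\<^sup>2)
        - (\<Sum>v\<in>V. wsum lam V (\<lambda>\<sigma>. (f \<sigma>)\<^sup>2) - wsum lam V (\<lambda>\<sigma>. f \<sigma> * heat_bath v f \<sigma>))"
    by (simp add: sum_subtractf)
  also have "(\<Sum>v\<in>V. wsum lam V (\<lambda>\<sigma>. (f \<sigma>)\<^sup>2) - wsum lam V (\<lambda>\<sigma>. f \<sigma> * heat_bath v f \<sigma>)) = dirichlet f"
  proof -
    have "dirichlet f = (\<Sum>R\<in>ind V. \<Sum>v\<in>avail R. lam / (1 + lam) * (lam ^ card R * (f (insert v R) - f R)\<^sup>2))"
      by (simp only: dirichlet_def sum_distrib_left)
    then show ?thesis unfolding sum_ind_avail_swap by (simp add: heat_bath_loss cong: sum.cong)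
  qed
  also have "1 / ?n * (?n * wsum lam V (\<lambda>\<sigma>. (f \<sigma>)\<^sup>2) - dirichlet f)
      = wsum lam V (\<lambda>\<sigma>. (f \<sigma>)\<^sup>2) - dirichlet f / ?n"
    using card_V_pos by (simp add: field_simps)
  finally show ?thesis .
qed

section \<open>The law of the chain as a density against the hardcore measure\<close>

lemma expectation_glauber_step:
  "measure_pmf.expectation (glauber_step V E lam \<sigma>) f = glauber_op f \<sigma>"
proof -
  let ?q = "\<lambda>v. let S = \<sigma> - {v} in if S \<union> {v} \<notin> ind V then return_pmf S
       else map_pmf (\<lambda>b. if b then S \<union> {v} else S) (bernoulli_pmf (lam / (1 + lam)))"
  have q: "measure_pmf.expectation (?q v) f = heat_bath v f \<sigma>" for v
  proof -
    have "lam / (1 + lam) \<le> 1" "0 \<le> lam / (1 + lam)" "1 - lam / (1 + lam) = 1 / (1 + lam)"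
      using lam by (auto simp: field_simps)
    then show ?thesis
      by (simp add: Let_def heat_bath_def add_divide_distrib)
  qed
  have "measure_pmf.expectation (glauber_step V E lam \<sigma>) f
      = (\<Sum>v\<in>V. measure_pmf.expectation (?q v) f) / real (card V)"
    unfolding glauber_step_def
    by (subst pmf_expectation_bind_pmf_of_set)
      (use V_ne finite_V in \<open>auto simp: Let_def sum_divide_distrib field_simps intro: sum.cong\<close>)
  then show ?thesis by (simp only: q glauber_op_def)
qed

lemma set_glauber_step:
  assumes "\<sigma> \<in> ind V"
  shows "set_pmf (glauber_step V E lam \<sigma>) \<subseteq> ind V"
proof -
  have "\<sigma> - {v} \<in> ind V" for v using assms by (auto simp: ind_iff)
  then show ?thesis
    unfolding glauber_step_def using V_ne finite_V by (auto simp: Let_def split: if_splits)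
qed

lemma set_iterate:
  assumes "x \<in> ind V"
  shows "set_pmf (iterate_kernel (glauber_step V E lam) t x) \<subseteq> ind V"
proof (induction t)
  case (Suc t)
  then show ?case using set_glauber_step by fastforce
qed (use assms in simp)

lemma pmf_as_expectation: "pmf p y = measure_pmf.expectation p (\<lambda>z. of_bool (z = y))"
proof -
  have "(\<lambda>z. of_bool (z = y)) = (indicat_real {y})" by (auto simp: indicator_def)
  then show ?thesis by (simp add: pmf.rep_eq)
qed

lemma hardcore_eq: "\<sigma> \<in> ind V \<Longrightarrow> hardcore V E lam \<sigma> = lam ^ card \<sigma> / Z lam V"
  by (simp add: hardcore_def partition_fun_def wsum_def)

lemma wsum_of_bool:
  assumes "y \<in> ind V"
  shows "wsum lam V (\<lambda>\<sigma>. g \<sigma> * of_bool (\<sigma> = y)) = lam ^ card y * g y"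
proof -
  have "wsum lam V (\<lambda>\<sigma>. g \<sigma> * of_bool (\<sigma> = y)) = (\<Sum>\<sigma>\<in>ind V. if \<sigma> = y then lam ^ card \<sigma> * g \<sigma> else 0)"
    unfolding wsum_def by (rule sum.cong) auto
  then show ?thesis using assms finite_ind[OF finite_V] by simp
qed

text \<open>The density of the chain started at \<open>x\<close> against the hardcore measure, minus
  1. By reversibility, densities evolve under the same operator as functions.\<close>

definition density_dev :: "'a set \<Rightarrow> nat \<Rightarrow> 'a set \<Rightarrow> real" where
  "density_dev x t = (glauber_op ^^ t) (\<lambda>\<sigma>. of_bool (\<sigma> = x) / hardcore V E lam x - 1)"

lemma pmf_iterate:
  assumes "x \<in> ind V" "y \<in> ind V"
  shows "pmf (iterate_kernel (glauber_step V E lam) t x) y = hardcore V E lam y * (1 + density_dev x t y)"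
  using assms(2)
proof (induction t arbitrary: y)
  case 0
  have "hardcore V E lam x > 0"
    using assms(1) lam Z_ge_1[OF finite_V, of lam] by (simp add: hardcore_eq)
  then show ?case by (auto simp: density_dev_def)
next
  case (Suc t)
  let ?Q = "iterate_kernel (glauber_step V E lam) t x"
  let ?y = "\<lambda>z. of_bool (z = y) :: real"
  have "pmf (iterate_kernel (glauber_step V E lam) (Suc t) x) y
      = measure_pmf.expectation ?Q (\<lambda>z. glauber_op ?y z)"
    by (simp add: pmf_bind pmf_as_expectation[of "glauber_step V E lam _"] expectation_glauber_step)
  also have "\<dots> = (\<Sum>z\<in>ind V. glauber_op ?y z * pmf ?Q z)"
    by (rule integral_measure_pmf_real) (use finite_ind[OF finite_V] set_iterate[OF assms(1)] in auto)
  also have "\<dots> = wsum lam V (\<lambda>z. (1 + density_dev x t z) * glauber_op ?y z) / Z lam V"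
    unfolding wsum_def sum_divide_distrib
    by (rule sum.cong[OF refl]) (simp add: Suc.IH hardcore_eq wsum_def)
  \<comment> \<open>Reversibility moves the operator from the indicator of \<open>y\<close> to the
    density.\<close>
  also have "\<dots> = wsum lam V (\<lambda>z. (1 + density_dev x (Suc t) z) * ?y z) / Z lam V"
    by (subst glauber_op_sym) (simp add: glauber_op_one_plus density_dev_def mult.commute)
  also have "\<dots> = hardcore V E lam y * (1 + density_dev x (Suc t) y)"
    using Suc.prems by (simp add: wsum_of_bool hardcore_eq)
  finally show ?case .
qed

section \<open>Decay in mean square and in total variation\<close>

lemma density_dev_mean:
  assumes "x \<in> ind V"
  shows "wsum lam V (density_dev x t) = 0"
proof (induction t)
  case 0
  have Z: "Z lam V > 0" using lam Z_ge_1[OF finite_V, of lam] by simp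
  have "wsum lam V (density_dev x 0)
     = wsum lam V (\<lambda>\<sigma>. 1 / hardcore V E lam x * of_bool (\<sigma> = x)) + wsum lam V (\<lambda>_. -1)"
    by (simp add: density_dev_def wsum_add[symmetric])
  also have "\<dots> = 0"
    by (subst wsum_of_bool[OF assms])
      (use lam Z in \<open>simp add: wsum_const[of _ _ "-1"] hardcore_eq[OF assms]\<close>)
  finally show ?case .
next
  case (Suc t)
  then show ?case using wsum_glauber_op_mean[of "density_dev x t"] by (simp add: density_dev_def)
qed

text \<open>The deviation keeps mean zero, so the Poincare inequality applies at every time and each
  step shrinks the square norm by a fixed factor. With \<open>h\<close> the stationary probability
  of \<open>x\<close>, the initial square norm is \<open>Z lam V / h - Z lam V\<close>.\<close>

lemma density_dev_norm:
  assumes x: "x \<in> ind V" and \<Gamma>: "real (card V) * \<Gamma> \<ge> 1" "\<Gamma> > 0"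
    and gap: "\<And>f. wsum lam V f = 0 \<Longrightarrow> wsum lam V (\<lambda>\<sigma>. (f \<sigma>)\<^sup>2) \<le> \<Gamma> * dirichlet f"
  shows "wsum lam V (\<lambda>\<sigma>. (density_dev x t \<sigma>)\<^sup>2)
    \<le> (1 - 1 / (real (card V) * \<Gamma>)) ^ t * (Z lam V / hardcore V E lam x)"
proof (induction t)
  case 0
  let ?h = "hardcore V E lam x"
  have Z: "Z lam V > 0" using lam Z_ge_1[OF finite_V, of lam] by simp
  have h: "?h > 0" using x lam Z by (simp add: hardcore_eq)
  have "wsum lam V (\<lambda>\<sigma>. (density_dev x 0 \<sigma>)\<^sup>2)
      = wsum lam V (\<lambda>\<sigma>. (1 / ?h\<^sup>2 - 2 / ?h) * of_bool (\<sigma> = x)) + wsum lam V (\<lambda>_. 1)"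
    unfolding wsum_add[symmetric]
    by (rule arg_cong[of _ _ "wsum lam V"]) (auto simp: density_dev_def power2_eq_square algebra_simps)
  also have "\<dots> = lam ^ card x * (1 / ?h\<^sup>2 - 2 / ?h) + Z lam V"
    by (subst wsum_of_bool[OF x]) simp
  also have "\<dots> = Z lam V / ?h - Z lam V"
  proof -
    have "lam ^ card x = ?h * Z lam V" using Z by (simp add: hardcore_eq[OF x])
    then show ?thesis using h by (simp add: field_simps power2_eq_square)
  qed
  finally show ?case using Z by simp
next
  case (Suc t)
  let ?r = "1 - 1 / (real (card V) * \<Gamma>)" and ?k = "density_dev x t"
  have r: "?r \<ge> 0" using \<Gamma> card_V_pos by (simp add: field_simps)
  have "wsum lam V (\<lambda>\<sigma>. (density_dev x (Suc t) \<sigma>)\<^sup>2)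
      \<le> wsum lam V (\<lambda>\<sigma>. (?k \<sigma>)\<^sup>2) - dirichlet ?k / real (card V)"
    using glauber_op_norm[of ?k] by (simp add: density_dev_def)
  also have "\<dots> \<le> wsum lam V (\<lambda>\<sigma>. (?k \<sigma>)\<^sup>2)
      - (wsum lam V (\<lambda>\<sigma>. (?k \<sigma>)\<^sup>2) / \<Gamma>) / real (card V)"
    using gap[OF density_dev_mean[OF x]] \<Gamma> card_V_pos
    by (intro diff_left_mono divide_right_mono) (auto simp: field_simps)
  also have "\<dots> = ?r * wsum lam V (\<lambda>\<sigma>. (?k \<sigma>)\<^sup>2)"
    by (simp add: algebra_simps)
  also have "\<dots> \<le> ?r * (?r ^ t * (Z lam V / hardcore V E lam x))"
    using Suc r by (rule mult_left_mono)
  finally show ?case by simp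
qed

text \<open>Twice the distance is the mean absolute density deviation, which the mean square
  controls by Cauchy-Schwarz, here as the nonnegativity of a variance.\<close>

lemma tv_dist_le:
  assumes x: "x \<in> ind V" and \<Gamma>: "real (card V) * \<Gamma> \<ge> 1" "\<Gamma> > 0"
    and gap: "\<And>f. wsum lam V f = 0 \<Longrightarrow> wsum lam V (\<lambda>\<sigma>. (f \<sigma>)\<^sup>2) \<le> \<Gamma> * dirichlet f"
  shows "(2 * tv_dist (ind V) (pmf (iterate_kernel (glauber_step V E lam) t x)) (hardcore V E lam))\<^sup>2
    \<le> (1 - 1 / (real (card V) * \<Gamma>)) ^ t / hardcore V E lam x"
proof -
  let ?k = "density_dev x t"
  have Z: "Z lam V > 0" using lam Z_ge_1[OF finite_V, of lam] by simp
  define c where "c = wsum lam V (\<lambda>\<sigma>. \<bar>?k \<sigma>\<bar>) / Z lam V"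
  have "2 * tv_dist (ind V) (pmf (iterate_kernel (glauber_step V E lam) t x)) (hardcore V E lam)
      = (\<Sum>\<sigma>\<in>ind V. hardcore V E lam \<sigma> * \<bar>?k \<sigma>\<bar>)"
  proof -
    have "\<bar>pmf (iterate_kernel (glauber_step V E lam) t x) \<sigma> - hardcore V E lam \<sigma>\<bar>
        = hardcore V E lam \<sigma> * \<bar>?k \<sigma>\<bar>" if "\<sigma> \<in> ind V" for \<sigma>
    proof -
      have "hardcore V E lam \<sigma> \<ge> 0" using that lam Z by (simp add: hardcore_eq)
      moreover have "pmf (iterate_kernel (glauber_step V E lam) t x) \<sigma> - hardcore V E lam \<sigma>
          = hardcore V E lam \<sigma> * ?k \<sigma>" by (simp add: pmf_iterate[OF x that] algebra_simps)
      ultimately show ?thesis by (simp add: abs_mult)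
    qed
    then show ?thesis by (simp add: tv_dist_def)
  qed
  also have "\<dots> = c"
    unfolding c_def wsum_def[of _ _ "\<lambda>\<sigma>. \<bar>_ \<sigma>\<bar>"] sum_divide_distrib
    by (rule sum.cong) (simp_all add: hardcore_eq)
  finally have tv: "2 * tv_dist (ind V) (pmf (iterate_kernel (glauber_step V E lam) t x)) (hardcore V E lam) = c" .
  have "0 \<le> wsum lam V (\<lambda>\<sigma>. (\<bar>?k \<sigma>\<bar> - c)\<^sup>2)" using lam by (intro wsum_nonneg) auto
  also have "\<dots> = wsum lam V (\<lambda>\<sigma>. ((?k \<sigma>)\<^sup>2 + (- 2 * c) * \<bar>?k \<sigma>\<bar>) + c\<^sup>2)"
    by (simp add: power2_eq_square algebra_simps)
  also have "\<dots> = wsum lam V (\<lambda>\<sigma>. (?k \<sigma>)\<^sup>2) - 2 * c * wsum lam V (\<lambda>\<sigma>. \<bar>?k \<sigma>\<bar>) + c\<^sup>2 * Z lam V"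
    by (simp only: wsum_add wsum_cmult wsum_const[of _ _ "c\<^sup>2"])
  also have "wsum lam V (\<lambda>\<sigma>. \<bar>?k \<sigma>\<bar>) = c * Z lam V" using Z by (simp add: c_def)
  finally have "c\<^sup>2 * Z lam V \<le> wsum lam V (\<lambda>\<sigma>. (?k \<sigma>)\<^sup>2)" by (simp add: power2_eq_square)
  also have "\<dots> \<le> (1 - 1 / (real (card V) * \<Gamma>)) ^ t * (Z lam V / hardcore V E lam x)"
    by (rule density_dev_norm) (use assms in auto)
  finally have "c\<^sup>2 * Z lam V \<le> (1 - 1 / (real (card V) * \<Gamma>)) ^ t / hardcore V E lam x * Z lam V"
    by simp
  then show ?thesis unfolding tv using Z by (rule mult_right_le_imp_le)
qed

end

end

section \<open>Mixing time\<close>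

context finite_graph
begin

lemma Z_le:
  assumes "U \<subseteq> V" "t \<ge> 0"
  shows "Z t U \<le> (1 + t) ^ card U"
proof -
  have "finite U" using assms(1) finite_V by (rule finite_subset)
  then show ?thesis
  proof (induction "card U" arbitrary: U rule: less_induct)
    case less
    show ?case
    proof (cases "U = {}")
      case True
      then have "ind U = {{}}" by (auto simp: ind_iff)
      then show ?thesis using True by (simp add: wsum_def)
    next
      case False
      then obtain w where w: "w \<in> U" by blast
      let ?W = "U - insert w (nb w)"
      have 1: "card (U - {w}) < card U" using w less.prems by (rule card_Diff1_less[rotated])
      have 2: "card ?W \<le> card (U - {w})" using less.prems by (intro card_mono) auto
      have "Z t U = Z t (U - {w}) + t * Z t ?W" using wsum_split[OF less.prems w] .
      also have "\<dots> \<le> (1 + t) ^ card (U - {w}) + t * (1 + t) ^ card (U - {w})"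
      proof (intro add_mono mult_left_mono)
        show "Z t (U - {w}) \<le> (1 + t) ^ card (U - {w})" using less.hyps[OF 1] less.prems by simp
        have "Z t ?W \<le> (1 + t) ^ card ?W" using less.hyps[of ?W] less.prems 1 2 by simp
        also have "\<dots> \<le> (1 + t) ^ card (U - {w})" using 2 assms(2) by (intro power_increasing) auto
        finally show "Z t ?W \<le> (1 + t) ^ card (U - {w})" .
      qed (use assms in auto)
      also have "\<dots> = (1 + t) ^ Suc (card (U - {w}))" by (simp add: algebra_simps)
      also have "Suc (card (U - {w})) = card U" using less.prems w by (rule card_Suc_Diff1)
      finally show ?thesis .
    qed
  qed
qed

lemma mixing_time_le:
  assumes "\<And>x. x \<in> ind V \<Longrightarrow> tv_dist (ind V) (pmf (iterate_kernel P T x)) \<mu> \<le> 1 / 4"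
  shows "mixing_time (ind V) P \<mu> \<le> enat T"
  unfolding mixing_time_def
proof (rule Max.boundedI)
  show "finite ((\<lambda>x. INF t\<in>{t. tv_dist (ind V) (pmf (iterate_kernel P t x)) \<mu> \<le> 1 / 4}. enat t) ` ind V)"
    using finite_ind[OF finite_V] by simp
  show "(\<lambda>x. INF t\<in>{t. tv_dist (ind V) (pmf (iterate_kernel P t x)) \<mu> \<le> 1 / 4}. enat t) ` ind V \<noteq> {}"
    using empty_in_ind by blast
next
  fix m assume "m \<in> (\<lambda>x. INF t\<in>{t. tv_dist (ind V) (pmf (iterate_kernel P t x)) \<mu> \<le> 1 / 4}. enat t) ` ind V"
  then obtain x where x: "x \<in> ind V"
    "m = (INF t\<in>{t. tv_dist (ind V) (pmf (iterate_kernel P t x)) \<mu> \<le> 1 / 4}. enat t)" by blast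
  show "m \<le> enat T" unfolding x(2) using assms[OF x(1)] by (intro INF_lower) simp
qed

text \<open>After \<open>T\<close> steps the decay factor is at most \<open>exp (- L)\<close>. The 4
  in the assumption on \<open>L\<close> brings the square of the doubled distance down to
  \<open>1 / 4\<close>.\<close>

lemma glauber_mixing_time_le:
  fixes lam \<Gamma> L :: real
  assumes lam: "lam > 0" and V: "V \<noteq> {}" and \<Gamma>: "\<Gamma> \<ge> 1"
    and gap: "\<And>f. wsum lam V f = 0 \<Longrightarrow> wsum lam V (\<lambda>\<sigma>. (f \<sigma>)\<^sup>2) \<le> \<Gamma> * dirichlet lam f"
    and L: "\<And>x. x \<in> ind V \<Longrightarrow> 4 * exp (- L) \<le> hardcore V E lam x" and T: "real (card V) * \<Gamma> * L \<le> real T"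
  shows "glauber_mixing_time V E lam \<le> enat T"
  unfolding glauber_mixing_time_def
proof (rule mixing_time_le)
  fix x assume x: "x \<in> ind V"
  let ?tv = "tv_dist (ind V) (pmf (iterate_kernel (glauber_step V E lam) T x)) (hardcore V E lam)"
  define N where "N = real (card V) * \<Gamma>"
  have "real (card V) \<ge> 1" using V finite_V by (simp add: Suc_le_eq card_gt_0_iff)
  then have N: "N \<ge> 1" using \<Gamma> mult_mono[of 1 "real (card V)" 1 \<Gamma>] by (simp add: N_def)
  have h: "hardcore V E lam x > 0" using L[OF x] exp_gt_zero[of "- L"] by linarith
  have "(1 - 1 / N) ^ T \<le> exp (- 1 / N) ^ T"
    using N exp_ge_add_one_self[of "- 1 / N"] by (intro power_mono) (auto simp: field_simps)
  also have "\<dots> = exp (- (real T / N))" by (simp flip: exp_of_nat_mult)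
  also have "\<dots> \<le> exp (- L)"
  proof -
    have "L * N \<le> real T" using T by (simp add: N_def mult.commute)
    then have "L \<le> real T / N" using N by (simp add: pos_le_divide_eq)
    then show ?thesis by simp
  qed
  also have "\<dots> \<le> hardcore V E lam x / 4" using L[OF x] by simp
  finally have "(1 - 1 / N) ^ T / hardcore V E lam x \<le> 1 / 4" using h by (simp add: field_simps)
  moreover have "(2 * ?tv)\<^sup>2 \<le> (1 - 1 / N) ^ T / hardcore V E lam x"
    unfolding N_def
  proof (rule tv_dist_le[OF lam V x])
    show "1 \<le> real (card V) * \<Gamma>" using N by (simp add: N_def)
    show "\<Gamma> > 0" using \<Gamma> by simp
  qed (rule gap)
  ultimately have "(2 * ?tv)\<^sup>2 \<le> 1 / 4" by linarith
  also have "(1 / 4 :: real) = (1 / 2)\<^sup>2" by (simp add: power2_eq_square)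
  finally have "2 * ?tv \<le> 1 / 2" by (rule power2_le_imp_le) simp
  then show "?tv \<le> 1 / 4" by simp
qed

text \<open>Every set has weight at least \<open>(1 / \<Delta>) ^ n\<close>, the partition function
  is at most \<open>exp (3 * n)\<close>, and \<open>4 \<le> exp 2\<close>. As
  \<open>ln \<Delta> \<ge> 1\<close>, the sum \<open>n * ln \<Delta> + 3 * n + 2\<close> is at most
  \<open>6 * n * ln \<Delta>\<close>.\<close>

lemma hardcore_lower:
  fixes \<Delta> :: nat
  assumes "\<Delta> \<ge> 3" "1 / real \<Delta> \<le> lam" "1 + lam \<le> exp 3" "V \<noteq> {}" "x \<in> ind V"
  shows "4 * exp (- (6 * real (card V) * ln (real \<Delta>))) \<le> hardcore V E lam x"
proof -
  let ?n = "card V" and ?l = "ln (real \<Delta>)"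
  have n: "real ?n \<ge> 1" using assms(4) finite_V by (simp add: Suc_le_eq card_gt_0_iff)
  have l: "?l \<ge> 1"
    using assms(1) exp_le by (subst ln_ge_iff) auto
  have "0 < 1 / real \<Delta>" using assms(1) by simp
  then have lam: "lam > 0" using assms(2) by linarith
  have xV: "x \<subseteq> V" using assms(5) by (simp add: ind_iff)
  have "exp (- (real ?n * ?l)) = (1 / real \<Delta>) ^ ?n"
    using assms(1) by (simp add: exp_minus exp_of_nat_mult power_divide inverse_eq_divide)
  also have "\<dots> \<le> (1 / real \<Delta>) ^ card x"
    using assms(1) card_mono[OF finite_V xV] by (intro power_decreasing) auto
  also have "\<dots> \<le> lam ^ card x" using assms(2) by (intro power_mono) auto
  finally have num: "exp (- (real ?n * ?l)) \<le> lam ^ card x" .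
  have "Z lam V \<le> (1 + lam) ^ ?n" using lam by (intro Z_le) auto
  also have "\<dots> \<le> exp 3 ^ ?n" using lam assms(3) by (intro power_mono) auto
  also have "\<dots> = exp (real ?n * 3)" by (simp only: exp_of_nat_mult)
  finally have den: "Z lam V \<le> exp (real ?n * 3)" .
  have Z: "Z lam V > 0" using lam Z_ge_1[OF finite_V, of lam] by simp
  have "4 * exp (- (6 * real ?n * ?l)) \<le> exp 2 * exp (- (6 * real ?n * ?l))"
    using exp_ge_one_plus_x_over_n_power_n[of 2 2] by (intro mult_right_mono) auto
  also have "\<dots> = exp (2 - 6 * real ?n * ?l)" by (simp flip: exp_add)
  also have "\<dots> \<le> exp (- (real ?n * ?l) - real ?n * 3)"
  proof -
    have "real ?n * 1 \<le> real ?n * ?l" using l n by (intro mult_left_mono) auto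
    then have "2 - 6 * real ?n * ?l \<le> - (real ?n * ?l) - real ?n * 3" using n by linarith
    then show ?thesis by (simp only: exp_le_cancel_iff)
  qed
  also have "\<dots> = exp (- (real ?n * ?l)) / exp (real ?n * 3)" by (rule exp_diff)
  also have "\<dots> \<le> lam ^ card x / Z lam V"
    using num den Z lam by (intro frac_le) auto
  finally show ?thesis by (simp add: hardcore_def assms(5) partition_fun_def wsum_def)
qed

end

lemma lambda_c_eq:
  assumes "\<Delta> \<ge> 3"
  shows "lambda_c \<Delta> = tree_fugacity (\<Delta> - 1) (1 / real (\<Delta> - 1))"
proof -
  obtain d where d: "\<Delta> = Suc d" "d \<ge> 2" using assms by (cases \<Delta>) auto
  have "1 - 1 / real d = (real d - 1) / real d" using d by (simp add: field_simps)
  then show ?thesis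
    using d by (simp add: lambda_c_def tree_fugacity_def power_divide)
qed

text \<open>The fugacity is \<open>1 / (d - 1)\<close> times \<open>(1 + 1 / (d - 1)) ^ d\<close>,
  hence at most \<open>exp 2\<close>; adding 1 costs at most a factor 2, which is below
  \<open>exp 1\<close>.\<close>

lemma tree_fugacity_critical_le:
  assumes "d \<ge> 2"
  shows "1 + tree_fugacity d (1 / real d) \<le> exp 3"
proof -
  have "tree_fugacity d (1 / real d) = (1 / (real d - 1)) * (real d / (real d - 1)) ^ d"
  proof -
    have "1 - 1 / real d = (real d - 1) / real d" using assms by (simp add: field_simps)
    then show ?thesis using assms by (simp add: tree_fugacity_def power_divide)
  qed
  also have "\<dots> \<le> 1 * exp (1 / (real d - 1)) ^ d"
  proof (intro mult_mono power_mono)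
    have "real d / (real d - 1) = 1 + 1 / (real d - 1)" using assms by (simp add: field_simps)
    then show "real d / (real d - 1) \<le> exp (1 / (real d - 1))"
      using exp_ge_add_one_self by metis
  qed (use assms in auto)
  also have "\<dots> = exp (real d / (real d - 1))" by (simp flip: exp_of_nat_mult)
  also have "\<dots> \<le> exp 2" using assms by (simp add: field_simps)
  finally have "1 + tree_fugacity d (1 / real d) \<le> exp 2 + exp 2" 
    using one_le_exp_iff[of "2::real"] by linarith
  also have "\<dots> \<le> exp 1 * exp 2" using exp_ge_add_one_self[of "1::real"] by simp
  also have "\<dots> = exp (3::real)" by (simp flip: exp_add)
  finally show ?thesis .
qed

text \<open>The Poincare constant \<open>exp 5 * n powr K\<close> is multiplied by \<open>n\<close>,
  for updating one vertex per step, and by \<open>6 * n * ln \<Delta>\<close>, which bounds the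
  logarithm of 4 over the smallest stationary probability. The exponent of \<open>n\<close> is
  \<open>K + 2\<close>.\<close>

theorem theorem1p1:
  "\<exists>C::real. C > 0 \<and>
     (\<forall>(\<Delta>::nat) (n::nat) (V::'a set) (E::'a set set).
        \<Delta> \<ge> 3 \<longrightarrow> simple_graph V E \<longrightarrow> card V = n \<longrightarrow> max_degree V E = \<Delta> \<longrightarrow>
        ereal_of_enat (glauber_mixing_time V E (lambda_c \<Delta>))
          \<le> ereal (C * real n powr (4 + 4 / (real \<Delta> - 2)) * ln (real \<Delta>)))"
proof (intro exI[of _ "12 * exp 5"] conjI allI impI)
  fix \<Delta> n :: nat and V :: "'a set" and E :: "'a set set"
  assume \<Delta>: "\<Delta> \<ge> 3" and G: "simple_graph V E" and n: "card V = n" and md: "max_degree V E = \<Delta>"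
  interpret finite_graph V E by unfold_locales (rule G)
  define d where "d = \<Delta> - 1"
  define lam where "lam = lambda_c \<Delta>"
  define K where "K = 2 * (real d + 1) / (real d - 1)"
  define \<Gamma> where "\<Gamma> = exp 5 * real n powr K"
  have d: "d \<ge> 2" "real \<Delta> = real d + 1" "d + 1 = \<Delta>" using \<Delta> by (auto simp: d_def)
  have lam_eq: "lam = tree_fugacity d (1 / real d)"
    unfolding lam_def d_def by (rule lambda_c_eq[OF \<Delta>])
  have deg: "card (nb v) \<le> d + 1" for v
  proof (cases "v \<in> V")
    case True
    then have "vertex_degree E v \<le> max_degree V E"
      unfolding max_degree_def using finite_V by (intro Max_ge) auto
    then show ?thesis using md d by (simp add: card_nb)
  next
    case False
    then have "nb v = {}" using G by (auto simp: nb_def simple_graph_def)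
    then show ?thesis by simp
  qed
  \<comment> \<open>Since \<open>\<Delta> \<ge> 3\<close>, the maximum is not the inserted 0, so
    some vertex attains it; together with its neighbours it gives \<open>n \<ge> 4\<close>.\<close>
  have "max_degree V E \<in> insert 0 (vertex_degree E ` V)"
    unfolding max_degree_def using finite_V by (intro Max_in) auto
  then obtain v where v: "v \<in> V" "card (nb v) = \<Delta>" using md \<Delta> by (auto simp: card_nb)
  have n4: "n \<ge> 4"
  proof -
    have "card (insert v (nb v)) \<le> card V"
      using v nb_subset finite_V by (intro card_mono) auto
    then show ?thesis using v \<Delta> n not_self_nb finite_nb by simp
  qed
  have V: "V \<noteq> {}" using v by auto
  have lam: "1 / real d \<le> lam / (1 + lam)" "lam > 0"
    using lam_bounds[OF d(1) deg lam_eq] by auto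
  have K: "K > 0" using d by (simp add: K_def)
  have \<Gamma>: "\<Gamma> \<ge> 1"
    using mult_mono[of 1 "exp 5" 1 "real n powr K"] n4 K by (simp add: \<Gamma>_def ge_one_powr_ge_zero)
  define L where "L = 6 * real n * ln (real \<Delta>)"
  have lnD: "ln (real \<Delta>) \<ge> 1"
    using \<Delta> exp_le by (subst ln_ge_iff) auto
  define T where "T = nat \<lceil>real n * \<Gamma> * L\<rceil>"
  have "glauber_mixing_time V E lam \<le> enat T"
  proof (rule glauber_mixing_time_le[OF lam(2) V \<Gamma>])
    show "wsum lam V (\<lambda>\<sigma>. (f \<sigma>)\<^sup>2) \<le> \<Gamma> * dirichlet lam f" if "wsum lam V f = 0" for f
      using poincare[OF d(1) deg lam_eq n, of f] n4 that
      unfolding dirichlet_def[OF lam(2) V] \<Gamma>_def K_def by simp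
    show "4 * exp (- L) \<le> hardcore V E lam x" if "x \<in> ind V" for x
      unfolding L_def n[symmetric]
    proof (rule hardcore_lower[OF \<Delta> _ _ V that])
      have "lam / (1 + lam) \<le> lam" using lam(2) by (simp add: field_simps)
      moreover have "1 / real \<Delta> \<le> 1 / real d" using d by (intro divide_left_mono) auto
      ultimately show "1 / real \<Delta> \<le> lam" using lam(1) by linarith
      show "1 + lam \<le> exp 3" unfolding lam_eq by (rule tree_fugacity_critical_le[OF d(1)])
    qed
    show "real (card V) * \<Gamma> * L \<le> real T" unfolding T_def n by (rule real_nat_ceiling_ge)
  qed
  then have "ereal_of_enat (glauber_mixing_time V E lam) \<le> ereal (real T)"
    using ereal_of_enat_le_iff[of _ "enat T"] by simp
  also have "real T \<le> 12 * exp 5 * real n powr (4 + 4 / (real \<Delta> - 2)) * ln (real \<Delta>)"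
  proof -
    have "real n * \<Gamma> \<ge> 1" using mult_mono[of 1 "real n" 1 \<Gamma>] \<Gamma> n4 by simp
    moreover have "L \<ge> 1"
      using mult_mono[of 1 "6 * real n" 1 "ln (real \<Delta>)"] lnD n4 by (simp add: L_def)
    ultimately have "real n * \<Gamma> * L \<ge> 1" using mult_mono[of 1 "real n * \<Gamma>" 1 L] by simp
    \<comment> \<open>Rounding up costs at most a factor 2 because the rounded number is at least 1;
      with the 6 in \<open>L\<close> this makes the constant 12.\<close>
    then have "real T \<le> 2 * (real n * \<Gamma> * L)" unfolding T_def by linarith
    also have "\<dots> = 12 * exp 5 * (real n powr K * real n * real n) * ln (real \<Delta>)"
      by (simp add: \<Gamma>_def L_def)
    also have "real n powr K * real n * real n = real n powr (K + 2)"
      using n4 by (simp add: powr_add power2_eq_square)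
    also have "K + 2 = 4 + 4 / (real \<Delta> - 2)"
      using d by (simp add: K_def field_simps)
    finally show ?thesis .
  qed
  finally show "ereal_of_enat (glauber_mixing_time V E (lambda_c \<Delta>))
      \<le> ereal (12 * exp 5 * real n powr (4 + 4 / (real \<Delta> - 2)) * ln (real \<Delta>))"
    by (simp add: lam_def)
qed simp

end
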